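(* Let $0<\alpha,\beta<\infty$, let $\varphi,\psi\in S(\mathbb{D})$ and $g,h\in H(\mathbb{D})$. Then the following statements are equivalent. (i) $C^g_\varphi-C^h_\psi:\mathcal{B}^\alpha\to\mathcal{B}^\beta$ is bounded. (iia) $\sup_{z\in\mathbb{D}}|D_{\varphi,g}(z)-D_{\psi,h}(z)|+\sup_{z\in\mathbb{D}}|D_{\psi,h}(z)|\rho(z)<\infty.$ (iib) $\sup_{z\in\mathbb{D}}|D_{\varphi,g}(z)-D_{\psi,h}(z)|+\sup_{z\in\mathbb{D}}|D_{\varphi,g}(z)|\rho(z)<\infty.$ (iii) $\sup_{a\in\mathbb{D}}\|(C^g_\varphi-C^h_\psi)f_a\|_{\mathcal{B}^\beta}+\sup_{a\in\mathbb{D}}\|(C^g_\varphi-C^h_\psi)g_a\|_{\mathcal{B}^\beta}<\infty.$ (iv) $\sup_{n\in\mathbb{N}}\sup_{z\in\mathbb{D}}(n+1)^\alpha(1-|z|^2)^\beta\,|\varphi(z)^n g(z)-\psi(z)^n h(z)|<\infty.$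
   Context: $\mathbb{D}$ is the open unit disk in $\mathbb{C}$, $H(\mathbb{D})$ is the set of analytic functions on $\mathbb{D}$, and $S(\mathbb{D})$ is the set of analytic self-maps of $\mathbb{D}$. For $0<\alpha<\infty$, the $\alpha$-Bloch space $\mathcal{B}^\alpha$ is the set of $f\in H(\mathbb{D})$ with $\|f\|_\alpha=\sup_{z\in\mathbb{D}}(1-|z|^2)^\alpha|f'(z)|<\infty$, a Banach space under the norm $\|f\|_{\mathcal{B}^\alpha}=|f(0)|+\|f\|_\alpha$; for $f\in H(\mathbb{D})\setminus\mathcal{B}^\alpha$ put $\|f\|_{\mathcal{B}^\alpha}=\infty$. For $g\in H(\mathbb{D})$ and $\varphi\in S(\mathbb{D})$, the generalized composition operator is $C^g_\varphi f(z)=\int_0^z f'(\varphi(\xi))g(\xi)\,d\xi$, $z\in\mathbb{D}$. For $\varphi,\psi\in S(\mathbb{D})$ and $g,h\in H(\mathbb{D})$ put $$\rho(z)=\left|\frac{\psi(z)-\varphi(z)}{1-\overline{\psi(z)}\varphi(z)}\right|,\quad D_{\varphi,g}(z)=\frac{(1-|z|^2)^\beta g(z)}{(1-|\varphi(z)|^2)^\alpha},\quad D_{\psi,h}(z)=\frac{(1-|z|^2)^\beta h(z)}{(1-|\psi(z)|^2)^\alpha}.$$ For $a\in\mathbb{D}$, the test functions are (with principal branches of the powers) $$f_a(z)=\int_0^z\frac{(1-|a|^2)^\alpha}{(1-\overline{a}u)^{2\alpha}}\,du,\qquad g_a(z)=\int_0^z\frac{(1-|a|^2)^\alpha}{(1-\overline{a}u)^{2\alpha}}\,\frac{a-u}{1-\overline{a}u}\,du.$$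 $\mathbb{N}=\{0,1,2,\dots\}$. *)

theory Defs
  imports "HOL-Complex_Analysis.Complex_Analysis"
begin

text \<open>
  Functions on the unit disc are total functions on the complex plane; all notions below
  depend only on their values inside the open disc. Suprema of nonnegative quantities are
  taken in \<^typ>\<open>ennreal\<close>, so that finiteness is \<open>< \<infinity>\<close>.
\<close>

abbreviation unit_disc :: "complex set"  (\<open>\<bbbD>\<close>)
  where "\<bbbD> \<equiv> ball 0 1"

definition analytic_self_maps :: "(complex \<Rightarrow> complex) set"
  where "analytic_self_maps = {\<phi>. \<phi> holomorphic_on \<bbbD> \<and> \<phi> ` \<bbbD> \<subseteq> \<bbbD>}"

definition bloch_seminorm :: "real \<Rightarrow> (complex \<Rightarrow> complex) \<Rightarrow> ennreal"
  where "bloch_seminorm \<alpha> f =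
    (SUP z\<in>\<bbbD>. ennreal ((1 - (cmod z)\<^sup>2) powr \<alpha> * cmod (deriv f z)))"

definition bloch_space :: "real \<Rightarrow> (complex \<Rightarrow> complex) set"
  where "bloch_space \<alpha> = {f. f holomorphic_on \<bbbD> \<and> bloch_seminorm \<alpha> f < \<infinity>}"

text \<open>For \<open>f\<close> holomorphic on the disc but outside the Bloch space, this norm is \<open>\<infinity>\<close>.\<close>

definition bloch_norm :: "real \<Rightarrow> (complex \<Rightarrow> complex) \<Rightarrow> ennreal"
  where "bloch_norm \<alpha> f = ennreal (cmod (f 0)) + bloch_seminorm \<alpha> f"

definition bloch_bounded ::
    "real \<Rightarrow> real \<Rightarrow> ((complex \<Rightarrow> complex) \<Rightarrow> (complex \<Rightarrow> complex)) \<Rightarrow> bool"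
  where "bloch_bounded \<alpha> \<beta> T \<longleftrightarrow>
    (\<exists>C\<ge>0. \<forall>f\<in>bloch_space \<alpha>.
       T f \<in> bloch_space \<beta> \<and> bloch_norm \<beta> (T f) \<le> ennreal C * bloch_norm \<alpha> f)"

text \<open>
  Integrals from \<open>0\<close> to \<open>z\<close> of holomorphic functions on the disc do not depend on the path;
  here they are taken along the straight segment.
\<close>

definition gen_comp_op ::
    "(complex \<Rightarrow> complex) \<Rightarrow> (complex \<Rightarrow> complex) \<Rightarrow> (complex \<Rightarrow> complex) \<Rightarrow> complex \<Rightarrow> complex"
  where "gen_comp_op \<phi> g f z =
    contour_integral (linepath 0 z) (\<lambda>\<xi>. deriv f (\<phi> \<xi>) * g \<xi>)"

definition gen_comp_diff ::
    "(complex \<Rightarrow> complex) \<Rightarrow> (complex \<Rightarrow> complex) \<Rightarrow> (complex \<Rightarrow> complex) \<Rightarrow> (complex \<Rightarrow> complex) \<Rightarrow>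
     (complex \<Rightarrow> complex) \<Rightarrow> complex \<Rightarrow> complex"
  where "gen_comp_diff \<phi> g \<psi> h f z = gen_comp_op \<phi> g f z - gen_comp_op \<psi> h f z"

definition pseudo_hyp_dist ::
    "(complex \<Rightarrow> complex) \<Rightarrow> (complex \<Rightarrow> complex) \<Rightarrow> complex \<Rightarrow> real"
  where "pseudo_hyp_dist \<phi> \<psi> z = cmod ((\<psi> z - \<phi> z) / (1 - cnj (\<psi> z) * \<phi> z))"

definition D_fun ::
    "real \<Rightarrow> real \<Rightarrow> (complex \<Rightarrow> complex) \<Rightarrow> (complex \<Rightarrow> complex) \<Rightarrow> complex \<Rightarrow> complex"
  where "D_fun \<alpha> \<beta> \<phi> g z =
    of_real ((1 - (cmod z)\<^sup>2) powr \<beta>) * g z / of_real ((1 - (cmod (\<phi> z))\<^sup>2) powr \<alpha>)"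

text \<open>The complex \<open>powr\<close> uses the principal branch of the logarithm.\<close>

definition test_f :: "real \<Rightarrow> complex \<Rightarrow> complex \<Rightarrow> complex"
  where "test_f \<alpha> a z =
    contour_integral (linepath 0 z)
      (\<lambda>u. of_real ((1 - (cmod a)\<^sup>2) powr \<alpha>) / (1 - cnj a * u) powr of_real (2 * \<alpha>))"

definition test_g :: "real \<Rightarrow> complex \<Rightarrow> complex \<Rightarrow> complex"
  where "test_g \<alpha> a z =
    contour_integral (linepath 0 z)
      (\<lambda>u. of_real ((1 - (cmod a)\<^sup>2) powr \<alpha>) / (1 - cnj a * u) powr of_real (2 * \<alpha>) *
           ((a - u) / (1 - cnj a * u)))"

end

(* Write D_phi, D_psi for the two D-functions and w_F z = (1 - |z|^2) powr alpha * F z for the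
weighted derivative F = f'.  Then (1 - |z|^2) powr beta times the derivative of the image of f is
|D_phi * w_F (phi z) - D_psi * w_F (psi z)|, and w_F is Lipschitz for the pseudo-hyperbolic
distance rho; hence (iia) gives (i).  Choosing the test functions with a = phi z or a = psi z,
where w_F (a) is 1 for f_a and 0 for g_a, recovers (iia) from (iii).  The monomials
z^(n+1)/(n+1) have Bloch seminorm of order (n + 1) powr (- alpha), so (i) gives (iv); conversely
the derivatives of the test functions are binomial series, and summing (iv) against their
coefficients gives (iii). *)

theory Submission
  imports Defs
begin

subsection \<open>Weighted holomorphic functions and the pseudo-hyperbolic distance\<close>

text \<open>The delicate direction is (iii) to (iia). Testing with f_a at a = \<phi> z controls
  D_phi - D_psi * L, where L is the weighted derivative of f_a at \<psi> z, and L differs from 1 by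
  at most a multiple of the pseudo-hyperbolic distance \<rho>. Replacing L by 1 therefore costs a
  multiple of |D_psi| * \<rho>, so that product has to be bounded first. The functions g_a give it
  only up to the factor (1 - \<rho>^2) powr \<alpha>, which degenerates as \<rho> tends to 1; there
  the second choice a = \<psi> z is brought in. In (iv) to (iii) the obstacle is uniformity in a.
  The Taylor coefficients of (1 - x) powr -(s + \<alpha>) are at most a constant times (n + 1) powr
  \<alpha> times those of (1 - x) powr -s. Dividing by the growth allowed in (iv) thus lowers the
  pole order by \<alpha>, and what remains is of size (1 - |a|) powr -s, which a prefactor (1 -
  |a|^2) powr s cancels. For f_a this is s = \<alpha>; for g_a the pole has order 2\<alpha> + 1 and
  one more factor 1 - |a|^2 must be found.\<close>

lemma one_minus_norm_square_pos:
  fixes z :: complex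
  assumes "z \<in> \<bbbD>" shows "0 < 1 - (cmod z)\<^sup>2"
  using assms by (simp add: power_less_one_iff abs_square_less_1)

lemma one_minus_cnj_mult_nonzero:
  fixes w z :: complex
  assumes "w \<in> \<bbbD>" "z \<in> \<bbbD>" shows "1 - cnj w * z \<noteq> 0"
proof
  assume "1 - cnj w * z = 0"
  then have "cmod (cnj w * z) = 1" by (metis eq_iff_diff_eq_0 norm_one)
  moreover have "cmod (cnj w * z) < 1"
    using assms norm_mult_less [of "cnj w" 1 z 1] by simp
  ultimately show False by simp
qed

text \<open>The identity |1 - conj(w) z|^2 - |z - w|^2 = (1 - |w|^2)(1 - |z|^2), divided by |1 -
  conj(w) z|^2. It links the weights to the pseudo-hyperbolic distance, both in Moebius changes of
  variable and for the test functions.\<close>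

lemma one_minus_norm_Moebius_square:
  assumes "w \<in> \<bbbD>" "z \<in> \<bbbD>"
  shows "1 - (cmod (Moebius_function 0 w z))\<^sup>2 =
    (1 - (cmod w)\<^sup>2) * (1 - (cmod z)\<^sup>2) / (cmod (1 - cnj w * z))\<^sup>2"
proof -
  have "(cmod (1 - cnj w * z))\<^sup>2 - (cmod (z - w))\<^sup>2 = (1 - (cmod w)\<^sup>2) * (1 - (cmod z)\<^sup>2)"
    unfolding cmod_power2 by (simp add: algebra_simps power2_eq_square)
  moreover have "(cmod (Moebius_function 0 w z))\<^sup>2 = (cmod (z - w))\<^sup>2 / (cmod (1 - cnj w * z))\<^sup>2"
    by (simp only: Moebius_function_simple norm_divide power_divide)
  then have "1 - (cmod (Moebius_function 0 w z))\<^sup>2 =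
      ((cmod (1 - cnj w * z))\<^sup>2 - (cmod (z - w))\<^sup>2) / (cmod (1 - cnj w * z))\<^sup>2"
    using one_minus_cnj_mult_nonzero[OF assms]
    by (simp add: diff_divide_distrib)
  ultimately show ?thesis by simp
qed

lemma Moebius_in_disc: "w \<in> \<bbbD> \<Longrightarrow> z \<in> \<bbbD> \<Longrightarrow> Moebius_function 0 w z \<in> \<bbbD>"
  using Moebius_function_norm_lt_1 by simp

lemma norm_Moebius_commute: "cmod (Moebius_function 0 w z) = cmod (Moebius_function 0 z w)"
proof -
  have "cmod (1 - cnj w * z) = cmod (cnj (1 - cnj w * z))" by (rule complex_mod_cnj [symmetric])
  also have "\<dots> = cmod (1 - cnj z * w)" by (simp add: mult.commute)
  finally show ?thesis
    by (simp only: Moebius_function_simple norm_divide norm_minus_commute)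
qed

section \<open>Lipschitz estimate for weighted holomorphic functions\<close>

text \<open>Cauchy's inequality on circles of radius 1/4 centred in |x| \<le> 1/2: these circles
  stay in |u| \<le> 3/4, which is why \<open>B\<close> is assumed there, and the radius gives the
  factor 4.\<close>

lemma holomorphic_lipschitz_at_0:
  assumes hol: "G holomorphic_on ball 0 1"
    and bd: "\<And>u. cmod u \<le> 3/4 \<Longrightarrow> cmod (G u) \<le> B"
    and \<zeta>: "cmod \<zeta> \<le> 1/2"
  shows "cmod (G \<zeta> - G 0) \<le> 4 * B * cmod \<zeta>"
proof -
  have deriv_bound: "cmod (deriv G x) \<le> 4 * B" if x: "x \<in> cball 0 (1/2)" for x
  proof -
    have sub: "cball x (1/4) \<subseteq> ball 0 1"
    proof
      fix y assume "y \<in> cball x (1/4)"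
      then show "y \<in> ball 0 1"
        using x norm_triangle_ineq[of x "y - x"] by (simp add: dist_norm norm_minus_commute)
    qed
    have "cmod ((deriv ^^ 1) G x) \<le> fact 1 * B / (1/4) ^ 1"
    proof (rule Cauchy_inequality)
      show "G holomorphic_on ball x (1/4)"
        using hol sub by (meson ball_subset_cball holomorphic_on_subset order_trans)
      show "continuous_on (cball x (1/4)) G"
        using hol sub by (meson holomorphic_on_imp_continuous_on holomorphic_on_subset)
      show "cmod (G y) \<le> B" if "cmod (x - y) = 1/4" for y
        using that x norm_triangle_ineq[of x "y - x"]
        by (intro bd) (simp add: norm_minus_commute)
    qed simp
    then show ?thesis by simp
  qed
  have "cmod (G \<zeta> - G 0) \<le> 4 * B * cmod (\<zeta> - 0)"
  proof (rule field_differentiable_bound)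
    show "convex (cball (0::complex) (1/2))" by simp
    show "(G has_field_derivative deriv G x) (at x within cball 0 (1/2))"
      if "x \<in> cball 0 (1/2)" for x
      using that by (intro holomorphic_derivI[OF hol]) auto
  qed (use deriv_bound \<zeta> in auto)
  then show ?thesis by simp
qed

text \<open>With x = \<alpha> * ln R this is |exp x - 1| \<le> |x| * exp |x|. The two bounds on
  \<open>R\<close> are reciprocal, so |ln R| is at most the logarithm of the larger one, hence at
  most 2\<rho>/(1 - \<rho>) \<le> 4\<rho>; here \<rho> \<le> 1/2 enters, as it does in |x| \<le>
  2\<alpha>.\<close>

lemma powr_minus_one_bound:
  fixes R \<rho> \<alpha> :: real
  assumes "0 < \<alpha>" "0 \<le> \<rho>" "\<rho> \<le> 1/2"
    and R: "(1 - \<rho>) / (1 + \<rho>) \<le> R" "R \<le> (1 + \<rho>) / (1 - \<rho>)"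
  shows "\<bar>R powr \<alpha> - 1\<bar> \<le> 4 * \<alpha> * exp (2 * \<alpha>) * \<rho>"
proof -
  have pos: "0 < (1 - \<rho>) / (1 + \<rho>)" using assms by simp
  with R have "R > 0" by linarith
  have top: "ln ((1 + \<rho>) / (1 - \<rho>)) \<le> 4 * \<rho>"
  proof -
    have "ln ((1 + \<rho>) / (1 - \<rho>)) \<le> (1 + \<rho>) / (1 - \<rho>) - 1"
      using assms by (intro ln_le_minus_one) auto
    also have "\<dots> \<le> 4 * \<rho>"
    proof -
      have "0 \<le> \<rho> * (1 - 2 * \<rho>)" using assms by simp
      then show ?thesis using assms by (simp add: field_simps)
    qed
    finally show ?thesis .
  qed
  have "ln R \<le> ln ((1 + \<rho>) / (1 - \<rho>))"
    using R \<open>R > 0\<close> assms by (subst ln_le_cancel_iff) auto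
  moreover have "ln ((1 - \<rho>) / (1 + \<rho>)) \<le> ln R"
    using R \<open>R > 0\<close> pos by (subst ln_le_cancel_iff) auto
  moreover have "ln ((1 - \<rho>) / (1 + \<rho>)) = - ln ((1 + \<rho>) / (1 - \<rho>))"
    using assms by (simp add: ln_div)
  ultimately have lnR: "\<bar>ln R\<bar> \<le> 4 * \<rho>" using top by linarith
  define x where "x = \<alpha> * ln R"
  have x: "\<bar>x\<bar> \<le> 4 * \<alpha> * \<rho>"
    using lnR assms by (simp add: x_def abs_mult)
  have "\<bar>x\<bar> \<le> 2 * \<alpha>"
    using x mult_left_mono[OF \<open>\<rho> \<le> 1/2\<close>, of "4 * \<alpha>"] assms by linarith
  have "\<bar>exp x - 1\<bar> \<le> \<bar>x\<bar> * exp \<bar>x\<bar>"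
  proof (cases "x \<ge> 0")
    case True
    have "exp x * (1 - x) \<le> exp x * exp (- x)"
      using exp_ge_add_one_self[of "-x"] by (intro mult_left_mono) auto
    then have "exp x - 1 \<le> x * exp x" by (simp add: algebra_simps flip: exp_add)
    then show ?thesis using True by simp
  next
    case False
    then have "\<bar>exp x - 1\<bar> \<le> \<bar>x\<bar>" using exp_ge_add_one_self[of x] by (simp, linarith)
    also have "\<dots> \<le> \<bar>x\<bar> * exp \<bar>x\<bar>" by (simp add: mult_le_cancel_left1)
    finally show ?thesis .
  qed
  also have "\<dots> \<le> (4 * \<alpha> * \<rho>) * exp (2 * \<alpha>)"
    using x \<open>\<bar>x\<bar> \<le> 2 * \<alpha>\<close> assms by (intro mult_mono) auto
  finally show ?thesis
    using \<open>R > 0\<close> by (simp add: powr_def x_def mult_ac)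
qed

text \<open>The summands belong to three sources of error in \<open>bloch_weight_lipschitz\<close>:
  the variation of \<open>F\<close>, the variation of the weight, and the trivial bound 2N, which is
  at most 4N\<rho> once \<rho> > 1/2.\<close>

definition bloch_lip :: "real \<Rightarrow> real"
  where "bloch_lip \<alpha> = 4 * (64/7) powr \<alpha> + 4 * \<alpha> * exp (2 * \<alpha>) + 4"

lemma bloch_lip_pos: "0 < \<alpha> \<Longrightarrow> 0 < bloch_lip \<alpha>"
  unfolding bloch_lip_def by (simp add: add_pos_pos)

text \<open>For \<open>\<rho> > 1/2\<close> the bound is trivial. Otherwise a Moebius map carries \<open>q\<close> to the origin, where
  Cauchy's estimate controls the variation of \<open>F\<close>, while the ratio of the two weights lies
  between \<open>((1 - \<rho>) / (1 + \<rho>)) powr \<alpha>\<close> and \<open>((1 + \<rho>) / (1 - \<rho>)) powr \<alpha>\<close>.\<close>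

lemma bloch_weight_lipschitz:
  assumes \<alpha>: "0 < \<alpha>" and hol: "F holomorphic_on \<bbbD>"
    and bd: "\<And>z. z \<in> \<bbbD> \<Longrightarrow> (1 - (cmod z)\<^sup>2) powr \<alpha> * cmod (F z) \<le> N"
    and p: "p \<in> \<bbbD>" and q: "q \<in> \<bbbD>"
  shows "cmod (of_real ((1 - (cmod p)\<^sup>2) powr \<alpha>) * F p - of_real ((1 - (cmod q)\<^sup>2) powr \<alpha>) * F q)
    \<le> bloch_lip \<alpha> * N * cmod (Moebius_function 0 q p)"
proof -
  define \<zeta> where "\<zeta> = Moebius_function 0 q p"
  define \<rho> where "\<rho> = cmod \<zeta>"
  define P where "P = (1 - (cmod p)\<^sup>2) powr \<alpha>"
  define Q where "Q = (1 - (cmod q)\<^sup>2) powr \<alpha>"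
  have \<zeta>D: "\<zeta> \<in> \<bbbD>" unfolding \<zeta>_def by (rule Moebius_in_disc[OF q p])
  have ppos: "0 < 1 - (cmod p)\<^sup>2" and qpos: "0 < 1 - (cmod q)\<^sup>2"
    by (rule one_minus_norm_square_pos[OF p], rule one_minus_norm_square_pos[OF q])
  have PQ: "P > 0" "Q > 0" using ppos qpos by (auto simp: P_def Q_def)
  have bp: "P * cmod (F p) \<le> N" and bq: "Q * cmod (F q) \<le> N"
    using bd[OF p] bd[OF q] by (auto simp: P_def Q_def)
  have "0 \<le> P * cmod (F p)" using PQ by simp
  with bp have N: "N \<ge> 0" by linarith
  have "\<rho> \<ge> 0" by (simp add: \<rho>_def)
  have triv: "cmod (of_real P * F p - of_real Q * F q) \<le> 2 * N"
    using bp bq PQ norm_triangle_ineq4[of "of_real P * F p" "of_real Q * F q"]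
    by (simp add: norm_mult)
  have "cmod (of_real P * F p - of_real Q * F q) \<le> bloch_lip \<alpha> * N * \<rho>"
  proof (cases "\<rho> \<le> 1/2")
    case False
    have "2 * N \<le> (4 * N) * \<rho>" using False N mult_left_mono[of "1/2" \<rho> "4 * N"] by simp
    also have "\<dots> \<le> bloch_lip \<alpha> * N * \<rho>"
      using N \<open>\<rho> \<ge> 0\<close> \<alpha> by (intro mult_right_mono) (auto simp: bloch_lip_def)
    finally show ?thesis using triv by linarith
  next
    case True
    have mq: "- q \<in> \<bbbD>" using q by simp
    define \<tau> where "\<tau> = Moebius_function 0 (- q)"
    have \<tau>D: "\<tau> u \<in> \<bbbD>" if "u \<in> \<bbbD>" for u
      unfolding \<tau>_def by (rule Moebius_in_disc[OF mq that])
    have \<tau>\<zeta>: "\<tau> \<zeta> = p" unfolding \<tau>_def \<zeta>_def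
      using p q by (intro Moebius_function_compose) auto
    have \<tau>0: "\<tau> 0 = q" by (simp add: \<tau>_def Moebius_function_simple)
    have \<tau>hol: "\<tau> holomorphic_on \<bbbD>"
      unfolding \<tau>_def using q by (intro Moebius_function_holomorphic) simp
    have \<tau>sq: "1 - (cmod (\<tau> u))\<^sup>2 = (1 - (cmod q)\<^sup>2) * (1 - (cmod u)\<^sup>2) / (cmod (1 + cnj q * u))\<^sup>2"
      if "u \<in> \<bbbD>" for u
      unfolding \<tau>_def using one_minus_norm_Moebius_square[OF mq that] by simp
    have nz: "1 + cnj q * u \<noteq> 0" if "u \<in> \<bbbD>" for u
      using one_minus_cnj_mult_nonzero[OF mq that] by simp
    \<comment> \<open>On |u| \<le> 3/4 one has 1 - |u|^2 \<ge> 7/16 and |1 + conj(q) u|^2 \<le> 4,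
      so 1 - |\<tau> u|^2 is at least 7/64 of 1 - |q|^2. This turns the weighted bound
      \<open>N\<close> at \<tau> u into a bound for \<open>F\<close> relative to the fixed weight
      \<open>Q\<close>.\<close>
    define B where "B = (64/7) powr \<alpha> * N / Q"
    have lip: "cmod ((F \<circ> \<tau>) \<zeta> - (F \<circ> \<tau>) 0) \<le> 4 * B * cmod \<zeta>"
    proof (rule holomorphic_lipschitz_at_0)
      show "F \<circ> \<tau> holomorphic_on ball 0 1"
        using \<tau>D by (intro holomorphic_on_compose_gen[OF \<tau>hol hol]) auto
      show "cmod \<zeta> \<le> 1/2" using True by (simp add: \<rho>_def)
      fix u :: complex assume u: "cmod u \<le> 3/4"
      then have uD: "u \<in> \<bbbD>" by simp
      have "(cmod u)\<^sup>2 \<le> (3/4)\<^sup>2" using u by (intro power_mono) auto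
      then have u2: "7/16 \<le> 1 - (cmod u)\<^sup>2" by (simp add: power2_eq_square)
      have "cmod (1 + cnj q * u) \<le> 1 + cmod q * cmod u"
        using norm_triangle_ineq[of 1 "cnj q * u"] by (simp add: norm_mult)
      also have "\<dots> \<le> 1 + 1 * 1" using q uD by (intro add_left_mono mult_mono) auto
      finally have "(cmod (1 + cnj q * u))\<^sup>2 \<le> 2\<^sup>2" by (intro power_mono) auto
      then have d: "(cmod (1 + cnj q * u))\<^sup>2 \<le> 4" by simp
      have "(1 - (cmod q)\<^sup>2) * (7/16) / 4 \<le> 1 - (cmod (\<tau> u))\<^sup>2"
        unfolding \<tau>sq[OF uD] using u2 d qpos nz[OF uD]
        by (intro frac_le mult_left_mono) auto
      then have "1 - (cmod q)\<^sup>2 \<le> (64/7) * (1 - (cmod (\<tau> u))\<^sup>2)" by simp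
      then have "Q \<le> ((64/7) * (1 - (cmod (\<tau> u))\<^sup>2)) powr \<alpha>"
        unfolding Q_def using \<alpha> qpos by (intro powr_mono2) auto
      also have "\<dots> = (64/7) powr \<alpha> * (1 - (cmod (\<tau> u))\<^sup>2) powr \<alpha>"
        using one_minus_norm_square_pos[OF \<tau>D[OF uD]] by (subst powr_mult) auto
      finally have "Q * cmod (F (\<tau> u)) \<le> ((64/7) powr \<alpha> * (1 - (cmod (\<tau> u))\<^sup>2) powr \<alpha>) * cmod (F (\<tau> u))"
        by (rule mult_right_mono) simp
      also have "\<dots> \<le> (64/7) powr \<alpha> * N"
        using mult_left_mono[OF bd[OF \<tau>D[OF uD]], of "(64/7) powr \<alpha>"] by (simp add: mult_ac)
      finally show "cmod ((F \<circ> \<tau>) u) \<le> B"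
        using PQ by (simp add: B_def field_simps)
    qed
    have first: "Q * cmod (F p - F q) \<le> 4 * (64/7) powr \<alpha> * N * \<rho>"
    proof -
      have "Q * cmod (F p - F q) \<le> Q * (4 * B * \<rho>)"
        using lip PQ by (intro mult_left_mono) (auto simp: \<tau>\<zeta> \<tau>0 \<rho>_def)
      also have "\<dots> = 4 * (64/7) powr \<alpha> * N * \<rho>" using PQ by (simp add: B_def)
      finally show ?thesis .
    qed
    define R where "R = (1 - (cmod q)\<^sup>2) / (1 - (cmod p)\<^sup>2)"
    have R: "R = (cmod (1 + cnj q * \<zeta>))\<^sup>2 / (1 - \<rho>\<^sup>2)"
      unfolding R_def using \<tau>sq[OF \<zeta>D] qpos nz[OF \<zeta>D] by (simp add: \<tau>\<zeta> \<rho>_def)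
    have q\<zeta>: "cmod (cnj q * \<zeta>) \<le> \<rho>"
      using q \<open>\<rho> \<ge> 0\<close> by (simp add: norm_mult \<rho>_def mult_left_le_one_le)
    have up: "cmod (1 + cnj q * \<zeta>) \<le> 1 + \<rho>"
      using norm_triangle_ineq[of 1 "cnj q * \<zeta>"] q\<zeta> by simp
    have low: "1 - \<rho> \<le> cmod (1 + cnj q * \<zeta>)"
      using norm_diff_ineq[of 1 "cnj q * \<zeta>"] q\<zeta> by simp
    have fac: "1 - \<rho>\<^sup>2 = (1 - \<rho>) * (1 + \<rho>)" by (simp add: algebra_simps power2_eq_square)
    have "R \<le> (1 + \<rho>)\<^sup>2 / (1 - \<rho>\<^sup>2)"
      unfolding R using up True \<open>\<rho> \<ge> 0\<close> by (intro divide_right_mono power_mono) (auto simp: fac)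
    also have "\<dots> = (1 + \<rho>) / (1 - \<rho>)"
      unfolding fac unfolding power2_eq_square using \<open>\<rho> \<ge> 0\<close> by (intro mult_divide_mult_cancel_right) auto
    finally have R1: "R \<le> (1 + \<rho>) / (1 - \<rho>)" .
    have "(1 - \<rho>) / (1 + \<rho>) = (1 - \<rho>)\<^sup>2 / (1 - \<rho>\<^sup>2)"
      unfolding fac unfolding power2_eq_square using True by (intro mult_divide_mult_cancel_left[symmetric]) auto
    also have "\<dots> \<le> R"
      unfolding R using low True \<open>\<rho> \<ge> 0\<close> by (intro divide_right_mono power_mono) (auto simp: fac)
    finally have R2: "(1 - \<rho>) / (1 + \<rho>) \<le> R" .
    have QR: "Q = P * R powr \<alpha>"
      using ppos qpos by (simp add: P_def Q_def R_def powr_divide)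
    have "P - Q = P * (1 - R powr \<alpha>)" unfolding QR by (simp add: algebra_simps)
    then have "\<bar>P - Q\<bar> = P * \<bar>R powr \<alpha> - 1\<bar>"
      using PQ by (simp add: abs_mult abs_minus_commute)
    also have "\<dots> \<le> P * (4 * \<alpha> * exp (2 * \<alpha>) * \<rho>)"
      using PQ by (intro mult_left_mono powr_minus_one_bound \<alpha> \<open>\<rho> \<ge> 0\<close> True R1 R2) auto
    finally have "\<bar>P - Q\<bar> * cmod (F p) \<le> (4 * \<alpha> * exp (2 * \<alpha>) * \<rho>) * (P * cmod (F p))"
      using mult_right_mono[of _ _ "cmod (F p)"] by (fastforce simp: mult_ac)
    also have "\<dots> \<le> (4 * \<alpha> * exp (2 * \<alpha>) * \<rho>) * N"
      using \<alpha> \<open>\<rho> \<ge> 0\<close> bp by (intro mult_left_mono) auto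
    finally have second: "\<bar>P - Q\<bar> * cmod (F p) \<le> (4 * \<alpha> * exp (2 * \<alpha>) * \<rho>) * N" .
    \<comment> \<open>The change of weight is paired with \<open>F p\<close>, because the bound for
      |P - Q| carries a factor \<open>P\<close> and P * |F p| \<le> N; the change of
      \<open>F\<close> is paired with \<open>Q\<close>, the weight at the point sent to the
      origin.\<close>
    have "of_real P * F p - of_real Q * F q = of_real (P - Q) * F p + of_real Q * (F p - F q)"
      by (simp add: algebra_simps)
    then have "cmod (of_real P * F p - of_real Q * F q) \<le> \<bar>P - Q\<bar> * cmod (F p) + Q * cmod (F p - F q)"
      using PQ norm_triangle_ineq[of "of_real (P - Q) * F p" "of_real Q * (F p - F q)"]
      by (simp only: norm_mult norm_of_real)
    also have "\<dots> \<le> (4 * \<alpha> * exp (2 * \<alpha>) * \<rho>) * N + 4 * (64/7) powr \<alpha> * N * \<rho>"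
      using first second by linarith
    also have "\<dots> \<le> bloch_lip \<alpha> * N * \<rho>"
      using N \<open>\<rho> \<ge> 0\<close> by (simp add: bloch_lip_def algebra_simps)
    finally show ?thesis .
  qed
  then show ?thesis by (simp add: P_def Q_def \<rho>_def \<zeta>_def)
qed

subsection \<open>Generalized composition operators\<close>

text \<open>The witness is \<open>enn2real\<close> of the supremum. It is nonnegative, so it also
  bounds negative values of \<open>f\<close>, which \<open>ennreal\<close> truncates to 0.\<close>

lemma SUP_ennreal_finite_iff:
  "(SUP x\<in>A. ennreal (f x)) < \<infinity> \<longleftrightarrow> (\<exists>M. \<forall>x\<in>A. f x \<le> M)"
proof
  assume fin: "(SUP x\<in>A. ennreal (f x)) < \<infinity>"
  have "f x \<le> enn2real (SUP x\<in>A. ennreal (f x))" if "x \<in> A" for x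
  proof -
    have "ennreal (f x) \<le> (SUP x\<in>A. ennreal (f x))" using that by (rule SUP_upper)
    also have "\<dots> = ennreal (enn2real (SUP x\<in>A. ennreal (f x)))" using fin by simp
    finally show ?thesis by (simp add: ennreal_le_iff)
  qed
  then show "\<exists>M. \<forall>x\<in>A. f x \<le> M" by blast
next
  assume "\<exists>M. \<forall>x\<in>A. f x \<le> M"
  then obtain M where "\<forall>x\<in>A. f x \<le> M" ..
  then have "(SUP x\<in>A. ennreal (f x)) \<le> ennreal M"
    by (intro SUP_least ennreal_leI) auto
  also have "\<dots> < \<infinity>" by simp
  finally show "(SUP x\<in>A. ennreal (f x)) < \<infinity>" .
qed

lemma SUP2_ennreal_finite_iff:
  "(SUP a\<in>A. SUP x\<in>B. ennreal (f a x)) < \<infinity> \<longleftrightarrow> (\<exists>M. \<forall>a\<in>A. \<forall>x\<in>B. f a x \<le> M)"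
proof -
  have "(SUP a\<in>A. SUP x\<in>B. ennreal (f a x)) = (SUP p\<in>A \<times> B. ennreal (case p of (a, x) \<Rightarrow> f a x))"
    by (intro antisym SUP_least) (auto intro: SUP_upper2 SUP_least)
  then show ?thesis by (simp only: SUP_ennreal_finite_iff) auto
qed

text \<open>The disc is convex, so \<open>G\<close> has a primitive \<open>P\<close> there, and the
  segment integral equals P w - P 0. The operators and the test functions are all differentiated
  through this.\<close>

lemma segment_integral_has_derivative:
  assumes "G holomorphic_on \<bbbD>" and z: "z \<in> \<bbbD>"
  shows "((\<lambda>w. contour_integral (linepath 0 w) G) has_field_derivative G z) (at z)"
proof -
  obtain P where P: "\<And>x. x \<in> \<bbbD> \<Longrightarrow> (P has_field_derivative G x) (at x within \<bbbD>)"
    using holomorphic_convex_primitive'[OF convex_ball open_ball assms(1)] by blast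
  have eq: "contour_integral (linepath 0 w) G = P w - P 0" if "w \<in> \<bbbD>" for w
  proof -
    have "closed_segment 0 w \<subseteq> \<bbbD>"
      using that by (intro closed_segment_subset) auto
    then have "(G has_contour_integral P (pathfinish (linepath 0 w)) - P (pathstart (linepath 0 w))) (linepath 0 w)"
      by (intro contour_integral_primitive[OF P]) auto
    then show ?thesis by (simp add: contour_integral_unique)
  qed
  have "(P has_field_derivative G z) (at z)"
    using P[OF z] at_within_open[OF z open_ball] by simp
  then have "((\<lambda>w. P w - P 0) has_field_derivative G z) (at z)"
    by (auto intro!: derivative_eq_intros)
  then show ?thesis
    by (rule has_field_derivative_transform_within_open[OF _ open_ball z]) (simp add: eq)
qed

lemma self_map_in_disc: "\<phi> \<in> analytic_self_maps \<Longrightarrow> z \<in> \<bbbD> \<Longrightarrow> \<phi> z \<in> \<bbbD>"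
  unfolding analytic_self_maps_def by blast

text \<open>\<open>F\<close> takes the place of the derivative of the function fed to the operator.
  Images vanish at 0, so the supremum of this quantity over the disc is their full Bloch norm, and
  monomials or test derivatives can be inserted for \<open>F\<close> without integrating
  them.\<close>

definition weighted_diff ::
    "real \<Rightarrow> (complex \<Rightarrow> complex) \<Rightarrow> (complex \<Rightarrow> complex) \<Rightarrow> (complex \<Rightarrow> complex) \<Rightarrow> (complex \<Rightarrow> complex) \<Rightarrow>
     (complex \<Rightarrow> complex) \<Rightarrow> complex \<Rightarrow> real"
  where "weighted_diff \<beta> \<phi> g \<psi> h F z =
    (1 - (cmod z)\<^sup>2) powr \<beta> * cmod (F (\<phi> z) * g z - F (\<psi> z) * h z)"

lemma gen_comp_op_has_derivative:
  assumes "\<phi> \<in> analytic_self_maps" "g holomorphic_on \<bbbD>" "f holomorphic_on \<bbbD>" "z \<in> \<bbbD>"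
  shows "(gen_comp_op \<phi> g f has_field_derivative deriv f (\<phi> z) * g z) (at z)"
proof -
  have "(deriv f \<circ> \<phi>) holomorphic_on \<bbbD>"
    using assms by (intro holomorphic_on_compose_gen[of _ _ _ \<bbbD>] holomorphic_deriv)
      (auto simp: analytic_self_maps_def)
  then have "(\<lambda>\<xi>. deriv f (\<phi> \<xi>) * g \<xi>) holomorphic_on \<bbbD>"
    using assms(2) by (intro holomorphic_on_mult) (auto simp: o_def)
  from segment_integral_has_derivative[OF this assms(4)] show ?thesis
    by (simp add: gen_comp_op_def[abs_def])
qed

lemma gen_comp_diff_has_derivative:
  assumes "\<phi> \<in> analytic_self_maps" "\<psi> \<in> analytic_self_maps" "g holomorphic_on \<bbbD>" "h holomorphic_on \<bbbD>"
    "f holomorphic_on \<bbbD>" "z \<in> \<bbbD>"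
  shows "(gen_comp_diff \<phi> g \<psi> h f has_field_derivative
    deriv f (\<phi> z) * g z - deriv f (\<psi> z) * h z) (at z)"
  unfolding gen_comp_diff_def[abs_def]
  using assms by (intro DERIV_diff gen_comp_op_has_derivative)

lemma bloch_norm_gen_comp_diff:
  assumes "\<phi> \<in> analytic_self_maps" "\<psi> \<in> analytic_self_maps" "g holomorphic_on \<bbbD>" "h holomorphic_on \<bbbD>"
    "f holomorphic_on \<bbbD>"
  shows "bloch_norm \<beta> (gen_comp_diff \<phi> g \<psi> h f) =
    (SUP z\<in>\<bbbD>. ennreal (weighted_diff \<beta> \<phi> g \<psi> h (deriv f) z))"
    and "bloch_seminorm \<beta> (gen_comp_diff \<phi> g \<psi> h f) =
    (SUP z\<in>\<bbbD>. ennreal (weighted_diff \<beta> \<phi> g \<psi> h (deriv f) z))"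
proof -
  have "gen_comp_diff \<phi> g \<psi> h f 0 = 0"
    by (simp add: gen_comp_diff_def gen_comp_op_def)
  moreover show s: "bloch_seminorm \<beta> (gen_comp_diff \<phi> g \<psi> h f) =
    (SUP z\<in>\<bbbD>. ennreal (weighted_diff \<beta> \<phi> g \<psi> h (deriv f) z))"
    unfolding bloch_seminorm_def
    by (intro SUP_cong refl)
      (simp add: weighted_diff_def DERIV_imp_deriv[OF gen_comp_diff_has_derivative[OF assms]])
  ultimately show "bloch_norm \<beta> (gen_comp_diff \<phi> g \<psi> h f) =
    (SUP z\<in>\<bbbD>. ennreal (weighted_diff \<beta> \<phi> g \<psi> h (deriv f) z))"
    by (simp add: bloch_norm_def)
qed

text \<open>\<open>N\<close> is specialised to the seminorm of \<open>f\<close>, with F = deriv f.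
  An estimate by the seminorm is enough because the norm only adds |f 0|; the same bound puts the
  image into the target space.\<close>

lemma bloch_boundedI:
  assumes ass: "\<phi> \<in> analytic_self_maps" "\<psi> \<in> analytic_self_maps" "g holomorphic_on \<bbbD>" "h holomorphic_on \<bbbD>"
    and "0 \<le> C"
    and bd: "\<And>F N z. \<lbrakk>F holomorphic_on \<bbbD>; \<And>u. u \<in> \<bbbD> \<Longrightarrow> (1 - (cmod u)\<^sup>2) powr \<alpha> * cmod (F u) \<le> N;
      z \<in> \<bbbD>\<rbrakk> \<Longrightarrow> weighted_diff \<beta> \<phi> g \<psi> h F z \<le> C * N"
  shows "bloch_bounded \<alpha> \<beta> (gen_comp_diff \<phi> g \<psi> h)"
  unfolding bloch_bounded_def
proof (intro exI conjI ballI)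
  show "0 \<le> C" by fact
  fix f assume "f \<in> bloch_space \<alpha>"
  then have f: "f holomorphic_on \<bbbD>" and fin: "bloch_seminorm \<alpha> f < \<infinity>"
    by (auto simp: bloch_space_def)
  define N where "N = enn2real (bloch_seminorm \<alpha> f)"
  have N: "bloch_seminorm \<alpha> f = ennreal N" "N \<ge> 0" using fin by (auto simp: N_def)
  have le: "(1 - (cmod u)\<^sup>2) powr \<alpha> * cmod (deriv f u) \<le> N" if "u \<in> \<bbbD>" for u
  proof -
    have "ennreal ((1 - (cmod u)\<^sup>2) powr \<alpha> * cmod (deriv f u)) \<le> ennreal N"
      unfolding N(1)[symmetric] bloch_seminorm_def using that by (rule SUP_upper)
    then show ?thesis using N(2) by (simp add: ennreal_le_iff)
  qed
  have "weighted_diff \<beta> \<phi> g \<psi> h (deriv f) z \<le> C * N" if "z \<in> \<bbbD>" for z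
    by (rule bd[OF _ le that]) (use f in \<open>auto intro: holomorphic_deriv\<close>)
  then have "(SUP z\<in>\<bbbD>. ennreal (weighted_diff \<beta> \<phi> g \<psi> h (deriv f) z)) \<le> ennreal (C * N)"
    by (intro SUP_least ennreal_leI) auto
  then have *: "(SUP z\<in>\<bbbD>. ennreal (weighted_diff \<beta> \<phi> g \<psi> h (deriv f) z)) \<le> ennreal C * bloch_seminorm \<alpha> f"
    by (simp add: N(1) ennreal_mult' \<open>0 \<le> C\<close>)
  have "gen_comp_diff \<phi> g \<psi> h f holomorphic_on \<bbbD>"
    using gen_comp_diff_has_derivative[OF ass f] holomorphic_on_open[OF open_ball] by blast
  moreover have "ennreal C * bloch_seminorm \<alpha> f < \<infinity>"
    by (simp add: N(1) ennreal_mult_less_top)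
  ultimately show "gen_comp_diff \<phi> g \<psi> h f \<in> bloch_space \<beta>"
    using * by (auto simp: bloch_space_def bloch_norm_gen_comp_diff[OF ass f])
  have "ennreal C * bloch_seminorm \<alpha> f \<le> ennreal C * bloch_norm \<alpha> f"
    unfolding bloch_norm_def by (intro mult_left_mono) auto
  with * show "bloch_norm \<beta> (gen_comp_diff \<phi> g \<psi> h f) \<le> ennreal C * bloch_norm \<alpha> f"
    by (simp add: bloch_norm_gen_comp_diff[OF ass f])
qed

text \<open>A given \<open>F\<close> is the derivative of its segment integral \<open>f\<close> from
  0, and f 0 = 0 makes the Bloch norm of \<open>f\<close> equal to its seminorm, hence at most
  \<open>N\<close>.\<close>

lemma bloch_boundedE:
  assumes ass: "\<phi> \<in> analytic_self_maps" "\<psi> \<in> analytic_self_maps" "g holomorphic_on \<bbbD>" "h holomorphic_on \<bbbD>"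
    and "bloch_bounded \<alpha> \<beta> (gen_comp_diff \<phi> g \<psi> h)"
  obtains C where "0 \<le> C"
    "\<And>F N z. \<lbrakk>F holomorphic_on \<bbbD>; \<And>u. u \<in> \<bbbD> \<Longrightarrow> (1 - (cmod u)\<^sup>2) powr \<alpha> * cmod (F u) \<le> N; z \<in> \<bbbD>\<rbrakk>
      \<Longrightarrow> weighted_diff \<beta> \<phi> g \<psi> h F z \<le> C * N"
proof -
  from assms(5) obtain C where "0 \<le> C" and C: "\<And>f. f \<in> bloch_space \<alpha> \<Longrightarrow>
      bloch_norm \<beta> (gen_comp_diff \<phi> g \<psi> h f) \<le> ennreal C * bloch_norm \<alpha> f"
    unfolding bloch_bounded_def by blast
  have "weighted_diff \<beta> \<phi> g \<psi> h F z \<le> C * N"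
    if F: "F holomorphic_on \<bbbD>" and N: "\<And>u. u \<in> \<bbbD> \<Longrightarrow> (1 - (cmod u)\<^sup>2) powr \<alpha> * cmod (F u) \<le> N"
      and z: "z \<in> \<bbbD>" for F N z
  proof -
    define f where "f = (\<lambda>w. contour_integral (linepath 0 w) F)"
    have der: "(f has_field_derivative F w) (at w)" if "w \<in> \<bbbD>" for w
      unfolding f_def using segment_integral_has_derivative[OF F that] .
    then have dF: "deriv f w = F w" if "w \<in> \<bbbD>" for w
      using that by (auto intro: DERIV_imp_deriv)
    have f: "f holomorphic_on \<bbbD>"
      using der holomorphic_on_open[OF open_ball] by blast
    have sn: "bloch_seminorm \<alpha> f \<le> ennreal N"
      unfolding bloch_seminorm_def using N by (intro SUP_least ennreal_leI) (simp add: dF)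
    then have fin: "f \<in> bloch_space \<alpha>"
      using f by (auto simp: bloch_space_def intro: le_less_trans)
    have "bloch_norm \<alpha> f \<le> ennreal N"
      using sn by (simp add: bloch_norm_def f_def)
    have N0: "N \<ge> 0" using order_trans[OF _ N[of 0]] by simp
    have pz: "\<phi> z \<in> \<bbbD>" "\<psi> z \<in> \<bbbD>" using ass z by (auto intro: self_map_in_disc simp del: mem_ball mem_ball_0)
    have "ennreal (weighted_diff \<beta> \<phi> g \<psi> h F z) = ennreal (weighted_diff \<beta> \<phi> g \<psi> h (deriv f) z)"
      using pz by (simp add: weighted_diff_def dF)
    also have "\<dots> \<le> bloch_norm \<beta> (gen_comp_diff \<phi> g \<psi> h f)"
      unfolding bloch_norm_gen_comp_diff[OF ass f] using z by (rule SUP_upper)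
    also have "\<dots> \<le> ennreal C * bloch_norm \<alpha> f" by (rule C[OF fin])
    also have "\<dots> \<le> ennreal C * ennreal N"
      by (intro mult_left_mono) (fact, simp)
    also have "\<dots> = ennreal (C * N)" using \<open>0 \<le> C\<close> N0 by (simp add: ennreal_mult)
    finally show ?thesis using \<open>0 \<le> C\<close> N0 by (simp add: ennreal_le_iff)
  qed
  with \<open>0 \<le> C\<close> that show thesis by blast
qed

subsection \<open>Test functions\<close>

definition test_f' :: "real \<Rightarrow> complex \<Rightarrow> complex \<Rightarrow> complex"
  where "test_f' \<alpha> a u =
    of_real ((1 - (cmod a)\<^sup>2) powr \<alpha>) / (1 - cnj a * u) powr of_real (2 * \<alpha>)"

definition test_g' :: "real \<Rightarrow> complex \<Rightarrow> complex \<Rightarrow> complex"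
  where "test_g' \<alpha> a u = test_f' \<alpha> a u * ((a - u) / (1 - cnj a * u))"

lemma one_minus_cnj_mult_Re_pos:
  assumes "a \<in> \<bbbD>" "u \<in> \<bbbD>" shows "0 < Re (1 - cnj a * u)"
proof -
  have "cmod (cnj a * u) < 1"
    using assms norm_mult_less [of "cnj a" 1 u 1] by simp
  then show ?thesis using complex_Re_le_cmod[of "cnj a * u"] by simp
qed

lemma test_f'_holomorphic:
  assumes a: "a \<in> \<bbbD>" shows "test_f' \<alpha> a holomorphic_on \<bbbD>"
proof -
  have "1 - cnj a * u \<notin> \<real>\<^sub>\<le>\<^sub>0" if "u \<in> \<bbbD>" for u
    unfolding complex_nonpos_Reals_iff using one_minus_cnj_mult_Re_pos[OF a that] by linarith
  moreover have "(1 - cnj a * u) powr of_real (2 * \<alpha>) \<noteq> 0" if "u \<in> \<bbbD>" for u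
    using one_minus_cnj_mult_nonzero[OF a that] by simp
  ultimately show ?thesis
    unfolding test_f'_def[abs_def] by (intro holomorphic_intros)
qed

lemma test_g'_holomorphic: "a \<in> \<bbbD> \<Longrightarrow> test_g' \<alpha> a holomorphic_on \<bbbD>"
  unfolding test_g'_def[abs_def]
  by (intro holomorphic_intros test_f'_holomorphic one_minus_cnj_mult_nonzero) auto

lemma test_f_has_derivative:
  "a \<in> \<bbbD> \<Longrightarrow> u \<in> \<bbbD> \<Longrightarrow> (test_f \<alpha> a has_field_derivative test_f' \<alpha> a u) (at u)"
  using segment_integral_has_derivative[OF test_f'_holomorphic]
  by (simp add: test_f_def[abs_def] test_f'_def[abs_def])

lemma test_g_has_derivative:
  "a \<in> \<bbbD> \<Longrightarrow> u \<in> \<bbbD> \<Longrightarrow> (test_g \<alpha> a has_field_derivative test_g' \<alpha> a u) (at u)"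
  using segment_integral_has_derivative[OF test_g'_holomorphic]
  by (simp add: test_g_def[abs_def] test_g'_def[abs_def] test_f'_def[abs_def])

text \<open>The exponent is real, so the modulus of the principal power is a power of the modulus.
  The weighted test derivative then sees \<open>a\<close> and \<open>u\<close> only through their
  pseudo-hyperbolic distance, which is symmetric in the two points.\<close>

lemma weight_test_f':
  assumes a: "a \<in> \<bbbD>" and u: "u \<in> \<bbbD>"
  shows "(1 - (cmod u)\<^sup>2) powr \<alpha> * cmod (test_f' \<alpha> a u) =
    (1 - (cmod (Moebius_function 0 a u))\<^sup>2) powr \<alpha>"
proof -
  have pos: "0 < 1 - (cmod a)\<^sup>2" "0 < 1 - (cmod u)\<^sup>2" "0 < cmod (1 - cnj a * u)"
    using one_minus_norm_square_pos[OF a] one_minus_norm_square_pos[OF u]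
      one_minus_cnj_mult_nonzero[OF a u] by auto
  have "cmod (1 - cnj a * u) powr (2 * \<alpha>) = ((cmod (1 - cnj a * u))\<^sup>2) powr \<alpha>"
    using pos powr_powr[of "cmod (1 - cnj a * u)" 2 \<alpha>] by simp
  then have "cmod (test_f' \<alpha> a u) = (1 - (cmod a)\<^sup>2) powr \<alpha> / ((cmod (1 - cnj a * u))\<^sup>2) powr \<alpha>"
    by (simp add: test_f'_def norm_divide norm_powr_real_powr')
  then show ?thesis
    using pos unfolding one_minus_norm_Moebius_square[OF a u]
    by (simp only: powr_divide powr_mult less_imp_le mult_nonneg_nonneg zero_le_power2) simp
qed

lemma weight_test_g':
  assumes a: "a \<in> \<bbbD>" and u: "u \<in> \<bbbD>"
  shows "(1 - (cmod u)\<^sup>2) powr \<alpha> * cmod (test_g' \<alpha> a u) =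
    (1 - (cmod (Moebius_function 0 a u))\<^sup>2) powr \<alpha> * cmod (Moebius_function 0 a u)"
  unfolding weight_test_f'[OF assms, symmetric]
  by (simp add: test_g'_def Moebius_function_simple norm_mult norm_divide norm_minus_commute)

text \<open>At u = a the base 1 - |a|^2 is a positive real, so the principal power is a real power.
  The value is recorded as a complex number and not only in modulus, since it enters differences
  such as D_phi - D_psi * L.\<close>

lemma test_f'_self:
  assumes a: "a \<in> \<bbbD>"
  shows "of_real ((1 - (cmod a)\<^sup>2) powr \<alpha>) * test_f' \<alpha> a a = 1"
proof -
  have pos: "0 < 1 - (cmod a)\<^sup>2" by (rule one_minus_norm_square_pos[OF a])
  have "1 - cnj a * a = of_real (1 - (cmod a)\<^sup>2)"
    by (simp add: complex_norm_square mult.commute del: of_real_power flip: of_real_power)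
  then have "(1 - cnj a * a) powr of_real (2 * \<alpha>) = of_real ((1 - (cmod a)\<^sup>2) powr (2 * \<alpha>))"
    using pos by (simp only: powr_of_real[OF less_imp_le])
  also have "\<dots> = of_real ((1 - (cmod a)\<^sup>2) powr \<alpha>) * of_real ((1 - (cmod a)\<^sup>2) powr \<alpha>)"
    by (simp flip: of_real_mult powr_add)
  finally show ?thesis using pos by (simp add: test_f'_def)
qed

lemma test_g'_self: "test_g' \<alpha> a a = 0"
  by (simp add: test_g'_def)

lemma weight_test_le_1:
  assumes "0 < \<alpha>" "a \<in> \<bbbD>" "u \<in> \<bbbD>"
  shows "(1 - (cmod u)\<^sup>2) powr \<alpha> * cmod (test_f' \<alpha> a u) \<le> 1"
    and "(1 - (cmod u)\<^sup>2) powr \<alpha> * cmod (test_g' \<alpha> a u) \<le> 1"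
proof -
  have "Moebius_function 0 a u \<in> \<bbbD>" by (rule Moebius_in_disc) fact+
  then have m: "cmod (Moebius_function 0 a u) \<le> 1" "(cmod (Moebius_function 0 a u))\<^sup>2 \<le> 1"
    by (auto intro: power_le_one)
  have *: "(1 - (cmod (Moebius_function 0 a u))\<^sup>2) powr \<alpha> \<le> 1"
    using m assms by (intro powr_le1) auto
  show "(1 - (cmod u)\<^sup>2) powr \<alpha> * cmod (test_f' \<alpha> a u) \<le> 1"
    using * by (simp add: weight_test_f'[OF assms(2,3)])
  show "(1 - (cmod u)\<^sup>2) powr \<alpha> * cmod (test_g' \<alpha> a u) \<le> 1"
    using mult_le_one[OF * _ m(1)] by (simp add: weight_test_g'[OF assms(2,3)])
qed

lemma test_condition_iff:
  assumes ass: "\<phi> \<in> analytic_self_maps" "\<psi> \<in> analytic_self_maps" "g holomorphic_on \<bbbD>" "h holomorphic_on \<bbbD>"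
  shows "(SUP a\<in>\<bbbD>. bloch_norm \<beta> (gen_comp_diff \<phi> g \<psi> h (test_f \<alpha> a))) +
      (SUP a\<in>\<bbbD>. bloch_norm \<beta> (gen_comp_diff \<phi> g \<psi> h (test_g \<alpha> a))) < \<infinity> \<longleftrightarrow>
    (\<exists>M. \<forall>a\<in>\<bbbD>. \<forall>z\<in>\<bbbD>. weighted_diff \<beta> \<phi> g \<psi> h (test_f' \<alpha> a) z \<le> M) \<and>
    (\<exists>M. \<forall>a\<in>\<bbbD>. \<forall>z\<in>\<bbbD>. weighted_diff \<beta> \<phi> g \<psi> h (test_g' \<alpha> a) z \<le> M)"
proof -
  have D: "\<phi> z \<in> \<bbbD>" "\<psi> z \<in> \<bbbD>" if "z \<in> \<bbbD>" for z
    using that ass by (auto intro: self_map_in_disc simp del: mem_ball mem_ball_0)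
  have "bloch_norm \<beta> (gen_comp_diff \<phi> g \<psi> h (test_f \<alpha> a)) =
      (SUP z\<in>\<bbbD>. ennreal (weighted_diff \<beta> \<phi> g \<psi> h (test_f' \<alpha> a) z))" if a: "a \<in> \<bbbD>" for a
  proof -
    have "test_f \<alpha> a holomorphic_on \<bbbD>"
      using test_f_has_derivative[OF a] holomorphic_on_open[OF open_ball] by blast
    from bloch_norm_gen_comp_diff(1)[OF ass this, of \<beta>] show ?thesis
      by (simp add: weighted_diff_def DERIV_imp_deriv[OF test_f_has_derivative[OF a D(1)]]
          DERIV_imp_deriv[OF test_f_has_derivative[OF a D(2)]] cong: SUP_cong_simp)
  qed
  moreover have "bloch_norm \<beta> (gen_comp_diff \<phi> g \<psi> h (test_g \<alpha> a)) =
      (SUP z\<in>\<bbbD>. ennreal (weighted_diff \<beta> \<phi> g \<psi> h (test_g' \<alpha> a) z))" if a: "a \<in> \<bbbD>" for a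
  proof -
    have "test_g \<alpha> a holomorphic_on \<bbbD>"
      using test_g_has_derivative[OF a] holomorphic_on_open[OF open_ball] by blast
    from bloch_norm_gen_comp_diff(1)[OF ass this, of \<beta>] show ?thesis
      by (simp add: weighted_diff_def DERIV_imp_deriv[OF test_g_has_derivative[OF a D(1)]]
          DERIV_imp_deriv[OF test_g_has_derivative[OF a D(2)]] cong: SUP_cong_simp)
  qed
  ultimately show ?thesis
    by (simp add: SUP2_ennreal_finite_iff[unfolded infinity_ennreal_def] cong: SUP_cong_simp)
qed

section \<open>Pointwise comparison of weighted differences with the D-functions\<close>

lemma weighted_diff_eq_D_fun:
  assumes "\<phi> z \<in> \<bbbD>" "\<psi> z \<in> \<bbbD>" 
  shows "weighted_diff \<beta> \<phi> g \<psi> h F z =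
    cmod (D_fun \<alpha> \<beta> \<phi> g z * (of_real ((1 - (cmod (\<phi> z))\<^sup>2) powr \<alpha>) * F (\<phi> z)) -
          D_fun \<alpha> \<beta> \<psi> h z * (of_real ((1 - (cmod (\<psi> z))\<^sup>2) powr \<alpha>) * F (\<psi> z)))"
proof -
  have "D_fun \<alpha> \<beta> \<phi> g z * (of_real ((1 - (cmod (\<phi> z))\<^sup>2) powr \<alpha>) * F (\<phi> z)) -
      D_fun \<alpha> \<beta> \<psi> h z * (of_real ((1 - (cmod (\<psi> z))\<^sup>2) powr \<alpha>) * F (\<psi> z)) =
      of_real ((1 - (cmod z)\<^sup>2) powr \<beta>) * (F (\<phi> z) * g z - F (\<psi> z) * h z)"
    using assms[THEN one_minus_norm_square_pos] by (simp add: D_fun_def field_simps)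
  then show ?thesis by (simp add: weighted_diff_def norm_mult)
qed

lemma pseudo_hyp_dist_eq: "pseudo_hyp_dist \<phi> \<psi> z = cmod (Moebius_function 0 (\<psi> z) (\<phi> z))"
  by (simp add: pseudo_hyp_dist_def Moebius_function_simple norm_divide norm_minus_commute)

text \<open>Either \<open>\<rho>\<close> is small and \<open>s\<close> is bounded below, or \<open>\<rho>\<close> is bounded below
  and \<open>B\<close> is controlled by passing through \<open>A\<close> and back.\<close>

lemma test_point_bounds:
  fixes A B L1 L2 :: complex and \<rho> M K \<alpha> s :: real
  assumes "0 < \<alpha>" "0 \<le> \<rho>" "\<rho> < 1" and s: "s = (1 - \<rho>\<^sup>2) powr \<alpha>"
    and L: "cmod L1 = s" "cmod L2 = s" and K: "cmod (1 - L1) \<le> K * \<rho>" "0 \<le> K"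
    and f: "cmod (A - B * L1) \<le> M" "cmod (A * L2 - B) \<le> M"
    and g: "cmod B * (s * \<rho>) \<le> M" "cmod A * (s * \<rho>) \<le> M"
  shows "cmod B * \<rho> \<le> (4/3) powr \<alpha> * M + 3 * M"
    and "cmod (A - B) \<le> M + K * ((4/3) powr \<alpha> * M + 3 * M)"
proof -
  have M: "0 \<le> M" using f(1) norm_ge_zero order_trans by blast
  show B: "cmod B * \<rho> \<le> (4/3) powr \<alpha> * M + 3 * M"
  proof (cases "\<rho> \<le> 1/2")
    case True
    then have "\<rho>\<^sup>2 \<le> (1/2)\<^sup>2" using assms by (intro power_mono) auto
    then have "3/4 \<le> 1 - \<rho>\<^sup>2" by (simp add: power2_eq_square)
    \<comment> \<open>For \<rho> \<le> 1/2 the factor \<open>s\<close> is at least (3/4) powr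
      \<alpha>, so multiplying by (4/3) powr \<alpha> removes it from the bound for |B| * s *
      \<rho>.\<close>
    then have "(3/4) powr \<alpha> \<le> s" unfolding s using assms by (intro powr_mono2) auto
    then have "1 \<le> (4/3) powr \<alpha> * s"
      using mult_left_mono[of "(3/4) powr \<alpha>" s "(4/3) powr \<alpha>"] by (simp flip: powr_mult)
    then have "1 * (cmod B * \<rho>) \<le> ((4/3) powr \<alpha> * s) * (cmod B * \<rho>)"
      using assms by (intro mult_right_mono) auto
    also have "\<dots> = (4/3) powr \<alpha> * (cmod B * (s * \<rho>))" by simp
    also have "\<dots> \<le> (4/3) powr \<alpha> * M" using g by (intro mult_left_mono) auto
    finally show ?thesis using M by simp
  next
    case False
    \<comment> \<open>Now \<rho> > 1/2 gives |A| * s \<le> 2M, and |A * L2| = |A| * s; one more M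
      for A * L2 - B makes 3M.\<close>
    have "0 \<le> cmod A * s" using assms by simp
    then have "cmod A * s * (1/2) \<le> cmod A * s * \<rho>" using False by (intro mult_left_mono) auto
    then have "cmod A * s \<le> 2 * M" using g(2) by (simp add: mult_ac)
    moreover have "cmod B \<le> cmod (A * L2) + cmod (A * L2 - B)"
      using norm_triangle_ineq4[of "A * L2" "A * L2 - B"] by simp
    ultimately have "cmod B \<le> 3 * M" using f(2) L by (simp add: norm_mult)
    moreover have "cmod B * \<rho> \<le> cmod B" using assms by (intro mult_right_le_one_le) auto
    moreover have "0 \<le> (4/3) powr \<alpha> * M" using M by simp
    ultimately show ?thesis by linarith
  qed
  \<comment> \<open>Replacing \<open>L1\<close> by 1 costs |B| * |1 - L1| \<le> K * |B| * \<rho>,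
    which the first conclusion bounds.\<close>
  have "cmod (A - B) = cmod ((A - B * L1) - B * (1 - L1))" by (simp add: algebra_simps)
  also have "\<dots> \<le> cmod (A - B * L1) + cmod (B * (1 - L1))" by (rule norm_triangle_ineq4)
  also have "\<dots> = cmod (A - B * L1) + cmod B * cmod (1 - L1)" by (simp add: norm_mult)
  also have "\<dots> \<le> M + cmod B * (K * \<rho>)"
    using f K by (intro add_mono mult_left_mono) auto
  also have "\<dots> = M + K * (cmod B * \<rho>)" by simp
  also have "\<dots> \<le> M + K * ((4/3) powr \<alpha> * M + 3 * M)"
    using B K by (intro add_left_mono mult_left_mono) auto
  finally show "cmod (A - B) \<le> M + K * ((4/3) powr \<alpha> * M + 3 * M)" .
qed

text \<open>Both test points are used at the same z: \<open>L1\<close> is the weighted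
  \<open>test_f'\<close> value at \<psi> z for a = \<phi> z, and \<open>L2\<close> the one at \<phi>
  z for a = \<psi> z. The Lipschitz estimate applies with N = 1 because weighted test derivatives
  are bounded by 1, and it compares \<open>L1\<close> with the value 1 at a itself.\<close>

lemma D_fun_bounds_from_test_functions:
  assumes \<alpha>: "0 < \<alpha>" and z: "\<phi> z \<in> \<bbbD>" "\<psi> z \<in> \<bbbD>"
    and f: "\<And>a. a \<in> \<bbbD> \<Longrightarrow> weighted_diff \<beta> \<phi> g \<psi> h (test_f' \<alpha> a) z \<le> M"
    and g: "\<And>a. a \<in> \<bbbD> \<Longrightarrow> weighted_diff \<beta> \<phi> g \<psi> h (test_g' \<alpha> a) z \<le> M"
  shows "cmod (D_fun \<alpha> \<beta> \<psi> h z) * pseudo_hyp_dist \<phi> \<psi> z \<le> (4/3) powr \<alpha> * M + 3 * M"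
    and "cmod (D_fun \<alpha> \<beta> \<phi> g z - D_fun \<alpha> \<beta> \<psi> h z) \<le>
      M + bloch_lip \<alpha> * ((4/3) powr \<alpha> * M + 3 * M)"
proof -
  let ?p = "\<phi> z" and ?q = "\<psi> z"
  define w where "w u = complex_of_real ((1 - (cmod u)\<^sup>2) powr \<alpha>)" for u
  define \<rho> where "\<rho> = pseudo_hyp_dist \<phi> \<psi> z"
  have \<rho>: "cmod (Moebius_function 0 ?q ?p) = \<rho>" "cmod (Moebius_function 0 ?p ?q) = \<rho>"
    unfolding \<rho>_def pseudo_hyp_dist_eq by (auto simp: norm_Moebius_commute)
  define s where "s = (1 - \<rho>\<^sup>2) powr \<alpha>"
  have \<rho>1: "0 \<le> \<rho>" "\<rho> < 1" using Moebius_in_disc[OF z] \<rho>(2) by auto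
  have L: "cmod (w ?q * test_f' \<alpha> ?p ?q) = s" "cmod (w ?p * test_f' \<alpha> ?q ?p) = s"
    using weight_test_f'[OF z] weight_test_f'[OF z(2) z(1)]
    by (simp_all add: w_def norm_mult s_def \<rho>)
  have G: "cmod (w ?q * test_g' \<alpha> ?p ?q) = s * \<rho>" "cmod (w ?p * test_g' \<alpha> ?q ?p) = s * \<rho>"
    using weight_test_g'[OF z] weight_test_g'[OF z(2) z(1)]
    by (simp_all add: w_def norm_mult s_def \<rho>)
  have self: "w ?p * test_f' \<alpha> ?p ?p = 1" "w ?q * test_f' \<alpha> ?q ?q = 1"
    using test_f'_self z by (auto simp: w_def)
  have "cmod (w ?p * test_f' \<alpha> ?p ?p - w ?q * test_f' \<alpha> ?p ?q) \<le> bloch_lip \<alpha> * 1 * \<rho>"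
    unfolding w_def \<rho>(1)[symmetric]
    by (rule bloch_weight_lipschitz) (use \<alpha> z in \<open>auto intro: test_f'_holomorphic weight_test_le_1\<close>)
  then have K: "cmod (1 - w ?q * test_f' \<alpha> ?p ?q) \<le> bloch_lip \<alpha> * \<rho>" by (simp add: self)
  note [simp] = weighted_diff_eq_D_fun[of \<phi> z \<psi> \<beta> g h _ \<alpha>, OF z, folded w_def]
  have f': "cmod (D_fun \<alpha> \<beta> \<phi> g z - D_fun \<alpha> \<beta> \<psi> h z * (w ?q * test_f' \<alpha> ?p ?q)) \<le> M"
      "cmod (D_fun \<alpha> \<beta> \<phi> g z * (w ?p * test_f' \<alpha> ?q ?p) - D_fun \<alpha> \<beta> \<psi> h z) \<le> M"
    using f[OF z(1)] f[OF z(2)] by (simp_all add: self)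
  have g1: "cmod (D_fun \<alpha> \<beta> \<psi> h z) * (s * \<rho>) \<le> M"
    using g[OF z(1)] unfolding G(1)[symmetric] by (simp add: test_g'_self norm_mult)
  have g2: "cmod (D_fun \<alpha> \<beta> \<phi> g z) * (s * \<rho>) \<le> M"
    using g[OF z(2)] unfolding G(2)[symmetric] by (simp add: test_g'_self norm_mult)
  note * = test_point_bounds[OF \<alpha> \<rho>1 s_def L K _ f' g1 g2]
  show "cmod (D_fun \<alpha> \<beta> \<psi> h z) * pseudo_hyp_dist \<phi> \<psi> z \<le> (4/3) powr \<alpha> * M + 3 * M"
    using *(1) bloch_lip_pos[OF \<alpha>] by (simp add: \<rho>_def)
  show "cmod (D_fun \<alpha> \<beta> \<phi> g z - D_fun \<alpha> \<beta> \<psi> h z) \<le>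
      M + bloch_lip \<alpha> * ((4/3) powr \<alpha> * M + 3 * M)"
    using *(2) bloch_lip_pos[OF \<alpha>] by simp
qed

text \<open>With \<open>P\<close>, \<open>Q\<close> the weighted values of \<open>F\<close> at the
  two image points and A, B the D-functions, A * P - B * Q = (A - B) * P + B * (P - Q). The
  Lipschitz estimate for P - Q supplies the factor \<rho> that \<open>M2\<close> controls next to
  |B|.\<close>

lemma weighted_diff_le:
  assumes \<alpha>: "0 < \<alpha>" and z: "\<phi> z \<in> \<bbbD>" "\<psi> z \<in> \<bbbD>"
    and F: "F holomorphic_on \<bbbD>" "\<And>u. u \<in> \<bbbD> \<Longrightarrow> (1 - (cmod u)\<^sup>2) powr \<alpha> * cmod (F u) \<le> N"
    and M: "cmod (D_fun \<alpha> \<beta> \<phi> g z - D_fun \<alpha> \<beta> \<psi> h z) \<le> M1"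
      "cmod (D_fun \<alpha> \<beta> \<psi> h z) * pseudo_hyp_dist \<phi> \<psi> z \<le> M2"
  shows "weighted_diff \<beta> \<phi> g \<psi> h F z \<le> (M1 + bloch_lip \<alpha> * M2) * N"
proof -
  let ?A = "D_fun \<alpha> \<beta> \<phi> g z" and ?B = "D_fun \<alpha> \<beta> \<psi> h z" and ?\<rho> = "pseudo_hyp_dist \<phi> \<psi> z"
  define P where "P = complex_of_real ((1 - (cmod (\<phi> z))\<^sup>2) powr \<alpha>) * F (\<phi> z)"
  define Q where "Q = complex_of_real ((1 - (cmod (\<psi> z))\<^sup>2) powr \<alpha>) * F (\<psi> z)"
  have P: "cmod P \<le> N" using F(2)[OF z(1)] by (simp add: P_def norm_mult)
  then have N: "0 \<le> N" using norm_ge_zero order_trans by blast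
  have PQ: "cmod (P - Q) \<le> bloch_lip \<alpha> * N * ?\<rho>"
    unfolding P_def Q_def pseudo_hyp_dist_eq by (rule bloch_weight_lipschitz[OF \<alpha> F z])
  have "weighted_diff \<beta> \<phi> g \<psi> h F z = cmod ((?A - ?B) * P + ?B * (P - Q))"
    unfolding weighted_diff_eq_D_fun[of \<phi> z \<psi> \<beta> g h F \<alpha>, OF z] P_def[symmetric] Q_def[symmetric]
    by (simp add: algebra_simps)
  also have "\<dots> \<le> cmod (?A - ?B) * cmod P + cmod ?B * cmod (P - Q)"
    using norm_triangle_ineq[of "(?A - ?B) * P" "?B * (P - Q)"] by (simp add: norm_mult)
  also have "\<dots> \<le> M1 * N + cmod ?B * (bloch_lip \<alpha> * N * ?\<rho>)"
    using M(1) P PQ N order_trans[OF norm_ge_zero M(1)] by (intro add_mono mult_mono) auto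
  also have "\<dots> = M1 * N + bloch_lip \<alpha> * N * (cmod ?B * ?\<rho>)" by simp
  also have "\<dots> \<le> M1 * N + bloch_lip \<alpha> * N * M2"
    using M(2) N bloch_lip_pos[OF \<alpha>] by (intro add_left_mono mult_left_mono) auto
  finally show ?thesis by (simp add: algebra_simps)
qed

subsection \<open>Powers and binomial series\<close>

text \<open>With x = 1 - |u|^2 one has |u| \<le> exp (-x/2), so for t = (n + 1) * x the claim
  reduces to t powr \<alpha> \<le> (2\<alpha>) powr \<alpha> * exp (t/2), which is y \<le> exp y at
  y = t/(2\<alpha>). The factor exp (1/2) pays for the exponent n in place of n + 1.\<close>

lemma weight_power_bound:
  assumes \<alpha>: "0 < \<alpha>" and u: "u \<in> \<bbbD>"
  shows "(1 - (cmod u)\<^sup>2) powr \<alpha> * cmod (u ^ n) \<le> exp (1/2) * (2 * \<alpha>) powr \<alpha> * real (n + 1) powr - \<alpha>"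
proof -
  define x where "x = 1 - (cmod u)\<^sup>2"
  have x: "0 < x" "x \<le> 1"
    using one_minus_norm_square_pos[OF u] by (simp_all add: x_def)
  have "(cmod u)\<^sup>2 \<le> exp (- x)"
    using exp_ge_add_one_self[of "- x"] by (simp add: x_def)
  also have "\<dots> = (exp (- x / 2))\<^sup>2" by (simp add: power2_eq_square flip: exp_add)
  finally have "cmod u \<le> exp (- x / 2)" by (rule power2_le_imp_le) simp
  then have "cmod (u ^ n) \<le> exp (- x / 2) ^ n"
    unfolding norm_power by (rule power_mono) simp
  then have un: "cmod (u ^ n) \<le> exp (- (x * n / 2))"
    by (simp add: mult_ac flip: exp_of_nat_mult)
  define t where "t = real (n + 1) * x"
  have t: "0 < t" using x by (simp add: t_def)
  have "t / (2 * \<alpha>) \<le> exp (t / (2 * \<alpha>))" using exp_ge_add_one_self[of "t / (2 * \<alpha>)"] by linarith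
  then have "(t / (2 * \<alpha>)) powr \<alpha> \<le> exp (t / (2 * \<alpha>)) powr \<alpha>"
    using t \<alpha> by (intro powr_mono2) auto
  also have "\<dots> = exp (t / 2)" using \<alpha> by (simp add: powr_def)
  finally have t\<alpha>: "t powr \<alpha> \<le> (2 * \<alpha>) powr \<alpha> * exp (t / 2)"
    using t \<alpha> by (simp add: powr_divide field_simps)
  have "x powr \<alpha> * cmod (u ^ n) = real (n + 1) powr - \<alpha> * (t powr \<alpha> * cmod (u ^ n))"
    using x by (simp add: t_def powr_mult powr_minus)
  also have "t powr \<alpha> * cmod (u ^ n) \<le> ((2 * \<alpha>) powr \<alpha> * exp (t / 2)) * exp (- (x * n / 2))"
    using t\<alpha> un by (intro mult_mono) auto
  also have "\<dots> = (2 * \<alpha>) powr \<alpha> * exp (x / 2)"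
    by (simp add: t_def algebra_simps add_divide_distrib flip: exp_add)
  also have "\<dots> \<le> (2 * \<alpha>) powr \<alpha> * exp (1 / 2)"
    using x by (intro mult_left_mono) auto
  finally show ?thesis by (simp add: x_def mult_ac mult_left_mono)
qed

text \<open>Both signs in the generalized binomial series are absorbed, leaving coefficients that
  are positive for s > 0. The complex form expands the kernels; the real form sums their
  majorants.\<close>

lemma binomial_series_complex:
  fixes x :: complex
  assumes "cmod x < 1"
  shows "(\<lambda>n. of_real (pochhammer s n / fact n) * x ^ n) sums (1 - x) powr - of_real s"
proof -
  have "(\<lambda>n. (- of_real s gchoose n) * (- x) ^ n) sums (1 + (- x)) powr - of_real s"
    using assms by (intro gen_binomial_complex) simp
  moreover have "(- of_real s gchoose n) * (- x) ^ n = of_real (pochhammer s n / fact n) * x ^ n" for n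
  proof -
    have "(- of_real s gchoose n) * (- x) ^ n =
        ((-1) ^ n * (-1) ^ n) * (of_real (pochhammer s n / fact n) * x ^ n)"
      by (subst power_minus) (simp add: gbinomial_pochhammer pochhammer_of_real)
    also have "(-1) ^ n * (-1) ^ n = (1 :: complex)" by (rule minus_one_mult_self)
    finally show ?thesis by simp
  qed
  ultimately show ?thesis by simp
qed

lemma binomial_series_real:
  fixes x :: real
  assumes "\<bar>x\<bar> < 1"
  shows "(\<lambda>n. pochhammer s n / fact n * x ^ n) sums (1 - x) powr - s"
proof -
  have "(\<lambda>n. (- s gchoose n) * (- x) ^ n) sums (1 + (- x)) powr - s"
    using assms by (intro gen_binomial_real) simp
  moreover have "(- s gchoose n) * (- x) ^ n = pochhammer s n / fact n * x ^ n" for n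
  proof -
    have "(- s gchoose n) * (- x) ^ n = ((-1) ^ n * (-1) ^ n) * (pochhammer s n / fact n * x ^ n)"
      by (subst power_minus) (simp add: gbinomial_pochhammer)
    also have "(-1) ^ n * (-1) ^ n = (1 :: real)" by (rule minus_one_mult_self)
    finally show ?thesis by simp
  qed
  ultimately show ?thesis by simp
qed

text \<open>The ratio of the two Pochhammer symbols is the product of 1 + \<alpha>/(s + k) for k
  from 0 to n. For k \<ge> 1 such a factor is at most ((s + k)/(s + k - 1)) powr \<alpha>, and these
  bounds telescope; the factor k = 0, where s + k - 1 may fail to be positive, is kept as (s +
  \<alpha>)/s.\<close>

lemma pochhammer_shift_growth:
  fixes s \<alpha> :: real
  assumes s: "0 < s" and \<alpha>: "0 < \<alpha>"
  shows "pochhammer (s + \<alpha>) (Suc n) \<le> (s + \<alpha>) / s * ((real n + s) / s) powr \<alpha> * pochhammer s (Suc n)"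
proof (induction n)
  case 0
  then show ?case using s by simp
next
  case (Suc n)
  define C where "C = (s + \<alpha>) / s"
  define y where "y = real n + s"
  have y: "y > 0" and C: "C > 0" using s \<alpha> by (auto simp: y_def C_def)
  have "ln (y / (y + 1)) \<le> y / (y + 1) - 1" using y by (intro ln_le_minus_one) auto
  also have "\<dots> = - (1 / (y + 1))" using y by (simp add: field_simps)
  finally have l: "1 / (y + 1) \<le> ln ((y + 1) / y)" using y by (simp add: ln_div)
  have "1 + \<alpha> / (y + 1) \<le> exp (\<alpha> * (1 / (y + 1)))"
    using exp_ge_add_one_self[of "\<alpha> / (y + 1)"] by simp
  also have "\<dots> \<le> exp (\<alpha> * ln ((y + 1) / y))"
    using l \<alpha> by (subst exp_le_cancel_iff) (intro mult_left_mono, auto)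
  also have "\<dots> = ((y + 1) / y) powr \<alpha>" using y by (simp add: powr_def)
  finally have step: "(1 + \<alpha> / (y + 1)) * (y + 1) \<le> ((y + 1) / y) powr \<alpha> * (y + 1)"
    using y by (intro mult_right_mono) auto
  have pos: "0 < pochhammer s (Suc n)" using s by (rule pochhammer_pos)
  have "pochhammer (s + \<alpha>) (Suc (Suc n)) = pochhammer (s + \<alpha>) (Suc n) * ((1 + \<alpha> / (y + 1)) * (y + 1))"
    using y by (simp add: pochhammer_Suc[of _ "Suc n"] y_def field_simps)
  also have "\<dots> \<le> (C * (y / s) powr \<alpha> * pochhammer s (Suc n)) * (((y + 1) / y) powr \<alpha> * (y + 1))"
  proof (rule mult_mono)
    show "pochhammer (s + \<alpha>) (Suc n) \<le> C * (y / s) powr \<alpha> * pochhammer s (Suc n)"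
      using Suc.IH by (simp only: C_def y_def)
    show "0 \<le> C * (y / s) powr \<alpha> * pochhammer s (Suc n)"
      using C pos by simp
  qed (use step y \<alpha> in auto)
  also have "\<dots> = C * ((y / s) powr \<alpha> * ((y + 1) / y) powr \<alpha>) * (pochhammer s (Suc n) * (y + 1))"
    by simp
  also have "(y / s) powr \<alpha> * ((y + 1) / y) powr \<alpha> = ((y + 1) / s) powr \<alpha>"
    using y s by (simp flip: powr_mult)
  also have "pochhammer s (Suc n) * (y + 1) = pochhammer s (Suc (Suc n))"
    by (simp add: pochhammer_Suc[of _ "Suc n"] y_def add_ac)
  finally show ?case by (simp add: C_def y_def add_ac)
qed

lemma pochhammer_shift_bound:
  fixes s \<alpha> :: real
  assumes s: "0 < s" and \<alpha>: "0 < \<alpha>"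
  obtains C where "0 < C"
    "\<And>n. pochhammer (s + \<alpha>) n \<le> C * pochhammer s n * real (n + 1) powr \<alpha>"
proof
  \<comment> \<open>The summand 1 serves n = 0, where both Pochhammer symbols are 1. The rest comes
    from the growth bound and m + s \<le> (s + 1) * (n + 1) with n = m + 1.\<close>
  define C where "C = 1 + (s + \<alpha>) / s * ((s + 1) / s) powr \<alpha>"
  show "0 < C" using s \<alpha> by (simp add: C_def add_pos_pos)
  fix n show "pochhammer (s + \<alpha>) n \<le> C * pochhammer s n * real (n + 1) powr \<alpha>"
  proof (cases n)
    case 0
    then show ?thesis using s \<alpha> by (simp add: C_def)
  next
    case (Suc m)
    have "real m + s \<le> (s + 1) * real (n + 1)" using s by (simp add: Suc algebra_simps)
    then have "((real m + s) / s) powr \<alpha> \<le> ((s + 1) / s * real (n + 1)) powr \<alpha>"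
    proof (intro powr_mono2)
      show "(real m + s) / s \<le> (s + 1) / s * real (n + 1)"
        using divide_right_mono[OF \<open>real m + s \<le> (s + 1) * real (n + 1)\<close>, of s] s by simp
    qed (use s \<alpha> in auto)
    also have "\<dots> = ((s + 1) / s) powr \<alpha> * real (n + 1) powr \<alpha>"
      using s by (intro powr_mult) 
    finally have "(s + \<alpha>) / s * ((real m + s) / s) powr \<alpha> * pochhammer s n
        \<le> (s + \<alpha>) / s * (((s + 1) / s) powr \<alpha> * real (n + 1) powr \<alpha>) * pochhammer s n"
      using s \<alpha> by (intro mult_right_mono mult_left_mono pochhammer_nonneg) auto
    also have "\<dots> \<le> C * pochhammer s n * real (n + 1) powr \<alpha>"
      using pochhammer_nonneg[OF s, of n] by (simp add: C_def algebra_simps)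
    finally show ?thesis using pochhammer_shift_growth[OF s \<alpha>, of m] by (simp add: Suc)
  qed
qed

section \<open>Transfer of the monomial bounds to kernels and test functions\<close>

text \<open>Termwise domination: the factor (n + 1) powr \<alpha> in the bound for
  \<open>b n\<close> is absorbed by the hypothesis on monomials, which leaves the summable majorant
  M * c n.\<close>

lemma weighted_diff_power_series:
  assumes z: "\<phi> z \<in> \<bbbD>" "\<psi> z \<in> \<bbbD>"
    and F: "\<And>u. u \<in> \<bbbD> \<Longrightarrow> (\<lambda>n. b n * u ^ (n + k)) sums F u"
    and M: "\<And>n. real (n + 1) powr \<alpha> * weighted_diff \<beta> \<phi> g \<psi> h (\<lambda>u. u ^ n) z \<le> M" 
    and \<alpha>: "0 < \<alpha>" and b: "\<And>n. cmod (b n) \<le> real (n + 1) powr \<alpha> * c n" and c: "c sums S"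
  shows "weighted_diff \<beta> \<phi> g \<psi> h F z \<le> M * S"
proof -
  define w where "w = (1 - (cmod z)\<^sup>2) powr \<beta>"
  have w: "0 \<le> w" by (simp add: w_def)
  have M0: "0 \<le> M"
  proof -
    have "0 \<le> weighted_diff \<beta> \<phi> g \<psi> h (\<lambda>u. u ^ 0) z" by (simp add: weighted_diff_def)
    also have "\<dots> \<le> M" using M[of 0] by simp
    finally show ?thesis .
  qed
  let ?d = "\<lambda>n. \<phi> z ^ (n + k) * g z - \<psi> z ^ (n + k) * h z"
  have "(\<lambda>n. b n * \<phi> z ^ (n + k) * g z - b n * \<psi> z ^ (n + k) * h z) sums (F (\<phi> z) * g z - F (\<psi> z) * h z)"
    using F[OF z(1)] F[OF z(2)] by (intro sums_diff sums_mult2)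
  then have "(\<lambda>n. of_real w * (b n * ?d n)) sums (of_real w * (F (\<phi> z) * g z - F (\<psi> z) * h z))"
    by (intro sums_mult) (simp add: algebra_simps)
  moreover have "cmod (of_real w * (b n * ?d n)) \<le> M * c n" for n
  proof -
    \<comment> \<open>The coefficient \<open>b n\<close> belongs to the power n + k, so the
      hypothesis offers the larger factor (n + k + 1) powr \<alpha>; the shift by \<open>k\<close>
      costs nothing.\<close>
    have "real (n + 1) powr \<alpha> * (w * cmod (?d n)) \<le> real (n + k + 1) powr \<alpha> * (w * cmod (?d n))"
      using w \<alpha> by (intro mult_right_mono powr_mono2) auto
    also have "\<dots> \<le> M" using M[of "n + k"] by (simp add: weighted_diff_def w_def)
    finally have 1: "real (n + 1) powr \<alpha> * (w * cmod (?d n)) \<le> M" .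
    have "0 \<le> real (n + 1) powr \<alpha> * c n" using b norm_ge_zero order_trans by blast
    then have c0: "0 \<le> c n" by (simp add: zero_le_mult_iff)
    have "cmod (of_real w * (b n * ?d n)) = cmod (b n) * (w * cmod (?d n))"
      using w by (simp add: norm_mult)
    also have "\<dots> \<le> (real (n + 1) powr \<alpha> * c n) * (w * cmod (?d n))"
      using b w by (intro mult_right_mono) auto
    also have "\<dots> = (real (n + 1) powr \<alpha> * (w * cmod (?d n))) * c n" by simp
    also have "\<dots> \<le> M * c n" using 1 c0 by (intro mult_right_mono)
    finally show ?thesis .
  qed
  ultimately have "cmod (of_real w * (F (\<phi> z) * g z - F (\<psi> z) * h z)) \<le> M * S"
    using norm_sums_le sums_mult[OF c, of M] by blast
  then show ?thesis using w by (simp add: weighted_diff_def w_def norm_mult)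
qed

text \<open>The exponent \<open>s\<close> of the prefactor is the amount by which the pole order s +
  \<alpha> exceeds the order \<alpha> that the monomial bounds absorb. The values s = \<alpha> and s
  = \<alpha> + 1 produce the test derivatives.\<close>

definition disc_kernel :: "real \<Rightarrow> real \<Rightarrow> complex \<Rightarrow> complex \<Rightarrow> complex"
  where "disc_kernel s \<alpha> a u =
    of_real ((1 - (cmod a)\<^sup>2) powr s) * (1 - cnj a * u) powr - of_real (s + \<alpha>)"

text \<open>The majorant of the coefficients sums to a multiple of (1 - |a|) powr -s, and (1 -
  |a|^2) powr s turns this into (1 + |a|) powr s \<le> 2 powr s. The constant is fixed before a, the
  maps and z, which is the uniformity that (iii) demands.\<close>

lemma weighted_diff_disc_kernel:
  assumes s: "0 < s" and \<alpha>: "0 < \<alpha>"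
  obtains C where "\<And>a k \<phi> g \<psi> h z M.
    \<lbrakk>a \<in> \<bbbD>; \<phi> z \<in> \<bbbD>; \<psi> z \<in> \<bbbD>;
     \<And>n. real (n + 1) powr \<alpha> * weighted_diff \<beta> \<phi> g \<psi> h (\<lambda>u. u ^ n) z \<le> M\<rbrakk>
    \<Longrightarrow> weighted_diff \<beta> \<phi> g \<psi> h (\<lambda>u. u ^ k * disc_kernel s \<alpha> a u) z \<le> M * C"
proof -
  obtain C where C: "0 < C"
    "\<And>n. pochhammer (s + \<alpha>) n \<le> C * pochhammer s n * real (n + 1) powr \<alpha>"
    using pochhammer_shift_bound[OF s \<alpha>] by blast
  have "weighted_diff \<beta> \<phi> g \<psi> h (\<lambda>u. u ^ k * disc_kernel s \<alpha> a u) z \<le> M * (C * 2 powr s)"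
    if a: "a \<in> \<bbbD>" and z: "\<phi> z \<in> \<bbbD>" "\<psi> z \<in> \<bbbD>"
      and M: "\<And>n. real (n + 1) powr \<alpha> * weighted_diff \<beta> \<phi> g \<psi> h (\<lambda>u. u ^ n) z \<le> M"
    for a k \<phi> g \<psi> h z M
  proof -
    define r where "r = (1 - (cmod a)\<^sup>2) powr s"
    define b where "b n = of_real (r * (pochhammer (s + \<alpha>) n / fact n)) * cnj a ^ n" for n
    define c where "c n = r * C * (pochhammer s n / fact n * cmod a ^ n)" for n
    have "(\<lambda>n. b n * u ^ (n + k)) sums (u ^ k * disc_kernel s \<alpha> a u)" if u: "u \<in> \<bbbD>" for u
    proof -
      have "cmod (cnj a * u) < 1"
        using a u norm_mult_less [of "cnj a" 1 u 1] by simp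
      from sums_mult[OF binomial_series_complex[OF this], of "u ^ k * of_real r" "s + \<alpha>"]
      show ?thesis
        by (simp add: disc_kernel_def b_def r_def power_mult_distrib power_add mult_ac)
    qed
    moreover have "cmod (b n) \<le> real (n + 1) powr \<alpha> * c n" for n
    proof -
      have "cmod (b n) = r * (pochhammer (s + \<alpha>) n / fact n) * cmod a ^ n"
        unfolding b_def norm_mult norm_power norm_of_real
        using s \<alpha> pochhammer_nonneg[of "s + \<alpha>" n] by (simp add: r_def abs_mult)
      also have "\<dots> \<le> r * ((C * pochhammer s n * real (n + 1) powr \<alpha>) / fact n) * cmod a ^ n"
        using C by (intro mult_right_mono mult_left_mono divide_right_mono) (auto simp: r_def)
      also have "\<dots> = real (n + 1) powr \<alpha> * c n" by (simp add: c_def)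
      finally show ?thesis .
    qed
    moreover have "c sums (r * C * (1 - cmod a) powr - s)"
      unfolding c_def using a by (intro sums_mult binomial_series_real) simp
    ultimately have "weighted_diff \<beta> \<phi> g \<psi> h (\<lambda>u. u ^ k * disc_kernel s \<alpha> a u) z
        \<le> M * (r * C * (1 - cmod a) powr - s)"
      by (rule weighted_diff_power_series[OF z _ M \<alpha>])
    also have "\<dots> \<le> M * (C * 2 powr s)"
    proof -
      have "r = ((1 + cmod a) * (1 - cmod a)) powr s"
        by (simp add: r_def algebra_simps power2_eq_square)
      also have "\<dots> = (1 + cmod a) powr s * (1 - cmod a) powr s"
        using a by (intro powr_mult) 
      finally have "r * (1 - cmod a) powr - s = (1 + cmod a) powr s"
        using a by (simp add: powr_minus)
      also have "\<dots> \<le> 2 powr s" using a s by (intro powr_mono2) auto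
      finally have "C * (r * (1 - cmod a) powr - s) \<le> C * 2 powr s"
        using C by (intro mult_left_mono) auto
      moreover have "0 \<le> M"
      proof -
        have "0 \<le> weighted_diff \<beta> \<phi> g \<psi> h (\<lambda>u. u ^ 0) z" by (simp add: weighted_diff_def)
        also have "\<dots> \<le> M" using M[of 0] by simp
        finally show ?thesis .
      qed
      ultimately show ?thesis by (intro mult_left_mono) (simp_all add: mult_ac)
    qed
    finally show ?thesis .
  qed
  then show thesis by (rule that)
qed

lemma test_f'_eq_disc_kernel: "test_f' \<alpha> a u = disc_kernel \<alpha> \<alpha> a u"
proof -
  have "(1 - cnj a * u) powr - of_real (\<alpha> + \<alpha>) = inverse ((1 - cnj a * u) powr of_real (2 * \<alpha>))"
    unfolding mult_2[symmetric] by (rule powr_minus)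
  then show ?thesis unfolding test_f'_def disc_kernel_def divide_inverse by (rule arg_cong[symmetric])
qed

text \<open>The splitting \<open>a - u = a * (1 - cnj a * u) - u * (1 - (cmod a)\<^sup>2)\<close> keeps the factor \<open>1 - (cmod a)\<^sup>2\<close>
  that compensates the extra pole; expanding \<open>a - u\<close> directly would lose it.\<close>

lemma test_g'_eq_disc_kernel:
  assumes a: "a \<in> \<bbbD>" and u: "u \<in> \<bbbD>"
  shows "test_g' \<alpha> a u = a * disc_kernel \<alpha> \<alpha> a u - u * disc_kernel (\<alpha> + 1) \<alpha> a u"
proof -
  define d where "d = 1 - cnj a * u"
  define r where "r = 1 - (cmod a)\<^sup>2"
  have d: "d \<noteq> 0" unfolding d_def by (rule one_minus_cnj_mult_nonzero[OF a u])
  have r: "r > 0" unfolding r_def by (rule one_minus_norm_square_pos[OF a])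
  have "a - u = a * d - u * of_real r"
    by (simp add: d_def r_def complex_norm_square algebra_simps del: of_real_power)
  then have 1: "(a - u) / d = a - u * of_real r / d" using d by (simp add: diff_divide_distrib)
  have 2: "d powr - of_real (\<alpha> + 1 + \<alpha>) = d powr - of_real (\<alpha> + \<alpha>) / d"
  proof -
    have "d powr - of_real (\<alpha> + 1 + \<alpha>) = d powr (- of_real (\<alpha> + \<alpha>) - 1)"
      by (rule arg_cong[where f = "(powr) d"]) simp
    also have "\<dots> = d powr - of_real (\<alpha> + \<alpha>) / d" using d by (simp add: powr_diff)
    finally show ?thesis .
  qed
  have 3: "r powr (\<alpha> + 1) = r powr \<alpha> * r" using r by (simp add: powr_add)
  show ?thesis
    unfolding test_g'_def test_f'_eq_disc_kernel disc_kernel_def d_def[symmetric] r_def[symmetric] 1 2 3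
    by (simp add: algebra_simps)
qed

lemma weighted_diff_test_from_powers:
  assumes \<alpha>: "0 < \<alpha>"
  shows "\<exists>C. \<forall>a \<phi> g \<psi> h z M. a \<in> \<bbbD> \<longrightarrow> \<phi> z \<in> \<bbbD> \<longrightarrow> \<psi> z \<in> \<bbbD> \<longrightarrow>
      (\<forall>n. real (n + 1) powr \<alpha> * weighted_diff \<beta> \<phi> g \<psi> h (\<lambda>u. u ^ n) z \<le> M) \<longrightarrow>
      weighted_diff \<beta> \<phi> g \<psi> h (test_f' \<alpha> a) z \<le> M * C \<and>
      weighted_diff \<beta> \<phi> g \<psi> h (test_g' \<alpha> a) z \<le> M * C"
proof -
  obtain C1 where C1: "\<And>a k \<phi> g \<psi> h z M.
    \<lbrakk>a \<in> \<bbbD>; \<phi> z \<in> \<bbbD>; \<psi> z \<in> \<bbbD>;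
     \<And>n. real (n + 1) powr \<alpha> * weighted_diff \<beta> \<phi> g \<psi> h (\<lambda>u. u ^ n) z \<le> M\<rbrakk>
    \<Longrightarrow> weighted_diff \<beta> \<phi> g \<psi> h (\<lambda>u. u ^ k * disc_kernel \<alpha> \<alpha> a u) z \<le> M * C1"
    using weighted_diff_disc_kernel[OF \<alpha> \<alpha>] by blast
  have "0 < \<alpha> + 1" using \<alpha> by simp
  then obtain C2 where C2: "\<And>a k \<phi> g \<psi> h z M.
    \<lbrakk>a \<in> \<bbbD>; \<phi> z \<in> \<bbbD>; \<psi> z \<in> \<bbbD>;
     \<And>n. real (n + 1) powr \<alpha> * weighted_diff \<beta> \<phi> g \<psi> h (\<lambda>u. u ^ n) z \<le> M\<rbrakk>
    \<Longrightarrow> weighted_diff \<beta> \<phi> g \<psi> h (\<lambda>u. u ^ k * disc_kernel (\<alpha> + 1) \<alpha> a u) z \<le> M * C2"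
    using weighted_diff_disc_kernel[OF _ \<alpha>] by blast
  have *: "weighted_diff \<beta> \<phi> g \<psi> h (test_f' \<alpha> a) z \<le> M * (C1 + C2) \<and>
      weighted_diff \<beta> \<phi> g \<psi> h (test_g' \<alpha> a) z \<le> M * (C1 + C2)"
    if a: "a \<in> \<bbbD>" and z: "\<phi> z \<in> \<bbbD>" "\<psi> z \<in> \<bbbD>"
      and M: "\<And>n. real (n + 1) powr \<alpha> * weighted_diff \<beta> \<phi> g \<psi> h (\<lambda>u. u ^ n) z \<le> M"
    for a \<phi> g \<psi> h z M
  proof -
    let ?w = "(1 - (cmod z)\<^sup>2) powr \<beta>"
    have f: "weighted_diff \<beta> \<phi> g \<psi> h (test_f' \<alpha> a) z \<le> M * C1"
      using C1[OF a z M, of 0] by (simp add: test_f'_eq_disc_kernel[abs_def])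
    define U where "U = weighted_diff \<beta> \<phi> g \<psi> h (\<lambda>u. u ^ 1 * disc_kernel (\<alpha> + 1) \<alpha> a u) z"
    \<comment> \<open>Besides entering the bound for \<open>test_g'\<close>, nonnegativity of
      \<open>U\<close> yields 0 \<le> M * C2, so that C1 + C2 also serves for
      \<open>test_f'\<close>; the sign of \<open>C2\<close> is not known directly.\<close>
    have U: "U \<le> M * C2" "0 \<le> U"
      unfolding U_def using C2[OF a z M, of 1] by (auto simp: weighted_diff_def)
    define X where "X = test_f' \<alpha> a (\<phi> z) * g z - test_f' \<alpha> a (\<psi> z) * h z"
    define Y where "Y = \<phi> z * disc_kernel (\<alpha> + 1) \<alpha> a (\<phi> z) * g z - \<psi> z * disc_kernel (\<alpha> + 1) \<alpha> a (\<psi> z) * h z"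
    have X: "weighted_diff \<beta> \<phi> g \<psi> h (test_f' \<alpha> a) z = ?w * cmod X"
      by (simp add: weighted_diff_def X_def)
    have Y: "U = ?w * cmod Y" by (simp add: U_def weighted_diff_def Y_def)
    have "weighted_diff \<beta> \<phi> g \<psi> h (test_g' \<alpha> a) z = ?w * cmod (a * X - Y)"
      unfolding weighted_diff_def test_g'_eq_disc_kernel[OF a z(1)] test_g'_eq_disc_kernel[OF a z(2)]
      by (simp add: X_def Y_def test_f'_eq_disc_kernel algebra_simps)
    also have "\<dots> \<le> ?w * (1 * cmod X + cmod Y)"
    proof (intro mult_left_mono)
      have "cmod a * cmod X \<le> 1 * cmod X" using a by (intro mult_right_mono) auto
      then show "cmod (a * X - Y) \<le> 1 * cmod X + cmod Y"
        using norm_triangle_ineq4[of "a * X" Y] by (simp add: norm_mult)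
    qed simp
    also have "\<dots> = weighted_diff \<beta> \<phi> g \<psi> h (test_f' \<alpha> a) z + U" by (simp add: X Y algebra_simps)
    finally show ?thesis using f U by (simp add: algebra_simps)
  qed
  show ?thesis by (intro exI[of _ "C1 + C2"]) (blast intro: * [THEN conjunct1] * [THEN conjunct2])
qed

subsection \<open>The equivalences\<close>

lemma weighted_diff_power:
  "real (n + 1) powr \<alpha> * weighted_diff \<beta> \<phi> g \<psi> h (\<lambda>u. u ^ n) z =
    real (n + 1) powr \<alpha> * (1 - (cmod z)\<^sup>2) powr \<beta> * cmod (\<phi> z ^ n * g z - \<psi> z ^ n * h z)"
  by (simp add: weighted_diff_def)

lemma pseudo_hyp_dist_le_1:
  assumes "\<phi> z \<in> \<bbbD>" "\<psi> z \<in> \<bbbD>"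
  shows "0 \<le> pseudo_hyp_dist \<phi> \<psi> z" "pseudo_hyp_dist \<phi> \<psi> z \<le> 1"
  using Moebius_in_disc[OF assms(2,1)] by (simp_all add: pseudo_hyp_dist_eq)

text \<open>As \<rho> \<le> 1, exchanging one D-function for the other in the product with \<rho>
  costs at most the modulus of their difference.\<close>

lemma D_fun_pseudo_hyp_dist_swap:
  assumes z: "\<phi> z \<in> \<bbbD>" "\<psi> z \<in> \<bbbD>"
    and M: "cmod (D_fun \<alpha> \<beta> \<phi> g z - D_fun \<alpha> \<beta> \<psi> h z) \<le> M1"
  shows "cmod (D_fun \<alpha> \<beta> \<phi> g z) * pseudo_hyp_dist \<phi> \<psi> z \<le>
      cmod (D_fun \<alpha> \<beta> \<psi> h z) * pseudo_hyp_dist \<phi> \<psi> z + M1"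
    and "cmod (D_fun \<alpha> \<beta> \<psi> h z) * pseudo_hyp_dist \<phi> \<psi> z \<le>
      cmod (D_fun \<alpha> \<beta> \<phi> g z) * pseudo_hyp_dist \<phi> \<psi> z + M1"
proof -
  define A B \<rho> where "A = D_fun \<alpha> \<beta> \<phi> g z" and "B = D_fun \<alpha> \<beta> \<psi> h z" and "\<rho> = pseudo_hyp_dist \<phi> \<psi> z"
  have \<rho>: "0 \<le> \<rho>" "\<rho> \<le> 1" unfolding \<rho>_def using z by (rule pseudo_hyp_dist_le_1)+
  have "cmod (A - B) * \<rho> \<le> cmod (A - B)" using \<rho> by (intro mult_right_le_one_le) auto
  with M have d: "cmod (A - B) * \<rho> \<le> M1" by (simp add: A_def B_def)
  have "cmod A * \<rho> \<le> (cmod B + cmod (A - B)) * \<rho>"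
    using \<rho> norm_triangle_sub[of A B] by (intro mult_right_mono) auto
  then show "cmod A * \<rho> \<le> cmod B * \<rho> + M1" using d by (simp add: distrib_right)
  have "cmod B * \<rho> \<le> (cmod A + cmod (A - B)) * \<rho>"
    using \<rho> norm_triangle_sub[of B A] by (intro mult_right_mono) (auto simp: norm_minus_commute)
  then show "cmod B * \<rho> \<le> cmod A * \<rho> + M1" using d by (simp add: distrib_right)
qed

theorem theorem3p3:
  fixes \<alpha> \<beta> :: real and \<phi> \<psi> g h :: "complex \<Rightarrow> complex"
  assumes "0 < \<alpha>" and "0 < \<beta>"
    and "\<phi> \<in> analytic_self_maps" and "\<psi> \<in> analytic_self_maps"
    and "g holomorphic_on \<bbbD>" and "h holomorphic_on \<bbbD>"
  shows
    "(bloch_bounded \<alpha> \<beta> (gen_comp_diff \<phi> g \<psi> h) \<longleftrightarrow>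
        (SUP z\<in>\<bbbD>. ennreal (cmod (D_fun \<alpha> \<beta> \<phi> g z - D_fun \<alpha> \<beta> \<psi> h z))) +
        (SUP z\<in>\<bbbD>. ennreal (cmod (D_fun \<alpha> \<beta> \<psi> h z) * pseudo_hyp_dist \<phi> \<psi> z)) < \<infinity>) \<and>
     (bloch_bounded \<alpha> \<beta> (gen_comp_diff \<phi> g \<psi> h) \<longleftrightarrow>
        (SUP z\<in>\<bbbD>. ennreal (cmod (D_fun \<alpha> \<beta> \<phi> g z - D_fun \<alpha> \<beta> \<psi> h z))) +
        (SUP z\<in>\<bbbD>. ennreal (cmod (D_fun \<alpha> \<beta> \<phi> g z) * pseudo_hyp_dist \<phi> \<psi> z)) < \<infinity>) \<and>
     (bloch_bounded \<alpha> \<beta> (gen_comp_diff \<phi> g \<psi> h) \<longleftrightarrow>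
        (SUP a\<in>\<bbbD>. bloch_norm \<beta> (gen_comp_diff \<phi> g \<psi> h (test_f \<alpha> a))) +
        (SUP a\<in>\<bbbD>. bloch_norm \<beta> (gen_comp_diff \<phi> g \<psi> h (test_g \<alpha> a))) < \<infinity>) \<and>
     (bloch_bounded \<alpha> \<beta> (gen_comp_diff \<phi> g \<psi> h) \<longleftrightarrow>
        (SUP n::nat. SUP z\<in>\<bbbD>. ennreal (real (n + 1) powr \<alpha> * (1 - (cmod z)\<^sup>2) powr \<beta> *
           cmod (\<phi> z ^ n * g z - \<psi> z ^ n * h z))) < \<infinity>)"
  (is "(?bounded \<longleftrightarrow> ?iia) \<and> (_ \<longleftrightarrow> ?iib) \<and> (_ \<longleftrightarrow> ?iii) \<and> (_ \<longleftrightarrow> ?iv)")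
proof -
  note \<alpha> = assms(1) and ass = assms(3-6)
  let ?A = "D_fun \<alpha> \<beta> \<phi> g" and ?B = "D_fun \<alpha> \<beta> \<psi> h" and ?\<rho> = "pseudo_hyp_dist \<phi> \<psi>"
    and ?wd = "weighted_diff \<beta> \<phi> g \<psi> h"
  have D: "\<phi> z \<in> \<bbbD>" "\<psi> z \<in> \<bbbD>" if "z \<in> \<bbbD>" for z
    using self_map_in_disc[OF _ that] ass by blast+
  have iia: "?iia \<longleftrightarrow> (\<exists>M. \<forall>z\<in>\<bbbD>. cmod (?A z - ?B z) \<le> M) \<and> (\<exists>M. \<forall>z\<in>\<bbbD>. cmod (?B z) * ?\<rho> z \<le> M)"
    by (simp only: infinity_ennreal_def ennreal_add_less_top SUP_ennreal_finite_iff[unfolded infinity_ennreal_def])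
  have iib: "?iib \<longleftrightarrow> (\<exists>M. \<forall>z\<in>\<bbbD>. cmod (?A z - ?B z) \<le> M) \<and> (\<exists>M. \<forall>z\<in>\<bbbD>. cmod (?A z) * ?\<rho> z \<le> M)"
    by (simp only: infinity_ennreal_def ennreal_add_less_top SUP_ennreal_finite_iff[unfolded infinity_ennreal_def])
  have iii: "?iii \<longleftrightarrow> (\<exists>M. \<forall>a\<in>\<bbbD>. \<forall>z\<in>\<bbbD>. ?wd (test_f' \<alpha> a) z \<le> M) \<and>
      (\<exists>M. \<forall>a\<in>\<bbbD>. \<forall>z\<in>\<bbbD>. ?wd (test_g' \<alpha> a) z \<le> M)"
    by (rule test_condition_iff[OF ass])
  have iv: "?iv \<longleftrightarrow> (\<exists>M. \<forall>n. \<forall>z\<in>\<bbbD>. real (n + 1) powr \<alpha> * ?wd (\<lambda>u. u ^ n) z \<le> M)"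
    unfolding SUP2_ennreal_finite_iff weighted_diff_power by simp
  \<comment> \<open>The implications form the cycle bounded, (iii), (iia), bounded, with the detour
    from bounded through (iv) to (iii) and the equivalence of (iia) and (iib).\<close>
  have "?iia" if "?iib"
  proof -
    from that obtain M1 M2 where M: "\<And>z. z \<in> \<bbbD> \<Longrightarrow> cmod (?A z - ?B z) \<le> M1"
      "\<And>z. z \<in> \<bbbD> \<Longrightarrow> cmod (?A z) * ?\<rho> z \<le> M2" unfolding iib by blast
    then have "cmod (?B z) * ?\<rho> z \<le> M2 + M1" if "z \<in> \<bbbD>" for z
      using D_fun_pseudo_hyp_dist_swap(2)[OF D[OF that] M(1)[OF that]] M(2)[OF that] by linarith
    with M(1) show ?thesis unfolding iia by blast
  qed
  moreover have "?iib" if "?iia"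
  proof -
    from that obtain M1 M2 where M: "\<And>z. z \<in> \<bbbD> \<Longrightarrow> cmod (?A z - ?B z) \<le> M1"
      "\<And>z. z \<in> \<bbbD> \<Longrightarrow> cmod (?B z) * ?\<rho> z \<le> M2" unfolding iia by blast
    then have "cmod (?A z) * ?\<rho> z \<le> M2 + M1" if "z \<in> \<bbbD>" for z
      using D_fun_pseudo_hyp_dist_swap(1)[OF D[OF that] M(1)[OF that]] M(2)[OF that] by linarith
    with M(1) show ?thesis unfolding iib by blast
  qed
  moreover have "?bounded" if "?iia"
  proof -
    from that obtain M1 M2 where M: "\<And>z. z \<in> \<bbbD> \<Longrightarrow> cmod (?A z - ?B z) \<le> M1"
      "\<And>z. z \<in> \<bbbD> \<Longrightarrow> cmod (?B z) * ?\<rho> z \<le> M2" unfolding iia by blast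
    \<comment> \<open>The operator bound must be a nonnegative constant; evaluating at 0 shows that
      \<open>M1\<close> and \<open>M2\<close> are nonnegative.\<close>
    have "0 \<in> \<bbbD>" by simp
    have "0 \<le> M1" using order_trans[OF norm_ge_zero M(1)[OF \<open>0 \<in> \<bbbD>\<close>]] .
    moreover have "0 \<le> M2"
      using pseudo_hyp_dist_le_1(1)[of \<phi> 0 \<psi>] D[OF \<open>0 \<in> \<bbbD>\<close>] M(2)[OF \<open>0 \<in> \<bbbD>\<close>]
      by (meson mult_nonneg_nonneg norm_ge_zero order_trans)
    ultimately have "0 \<le> M1 + bloch_lip \<alpha> * M2" using bloch_lip_pos[OF \<alpha>] by simp
    then show ?thesis
      by (rule bloch_boundedI[OF ass]) (rule weighted_diff_le[OF \<alpha> D _ _ M])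
  qed
  moreover have "?iii" if bounded: "?bounded"
  proof -
    obtain C where C: "\<And>F N z. \<lbrakk>F holomorphic_on \<bbbD>;
        \<And>u. u \<in> \<bbbD> \<Longrightarrow> (1 - (cmod u)\<^sup>2) powr \<alpha> * cmod (F u) \<le> N; z \<in> \<bbbD>\<rbrakk> \<Longrightarrow> ?wd F z \<le> C * N"
      using bloch_boundedE[OF ass bounded] by metis
    have "?wd (test_f' \<alpha> a) z \<le> C * 1 \<and> ?wd (test_g' \<alpha> a) z \<le> C * 1" if "a \<in> \<bbbD>" "z \<in> \<bbbD>" for a z
      using that \<alpha> by (intro conjI C test_f'_holomorphic test_g'_holomorphic weight_test_le_1)
    then show ?thesis unfolding iii by blast
  qed
  moreover have "?iia" if "?iii"
  proof -
    from that obtain Mf Mg where "\<And>a z. a \<in> \<bbbD> \<Longrightarrow> z \<in> \<bbbD> \<Longrightarrow> ?wd (test_f' \<alpha> a) z \<le> Mf"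
      "\<And>a z. a \<in> \<bbbD> \<Longrightarrow> z \<in> \<bbbD> \<Longrightarrow> ?wd (test_g' \<alpha> a) z \<le> Mg" unfolding iii by blast
    then have "\<And>a z. a \<in> \<bbbD> \<Longrightarrow> z \<in> \<bbbD> \<Longrightarrow> ?wd (test_f' \<alpha> a) z \<le> max Mf Mg"
      "\<And>a z. a \<in> \<bbbD> \<Longrightarrow> z \<in> \<bbbD> \<Longrightarrow> ?wd (test_g' \<alpha> a) z \<le> max Mf Mg"
      by (meson max.coboundedI1 max.coboundedI2)+
    note bounds = D_fun_bounds_from_test_functions[OF \<alpha> D this]
    show ?thesis unfolding iia using bounds by blast
  qed
  moreover have "?iv" if bounded: "?bounded"
  proof -
    obtain C where C: "\<And>F N z. \<lbrakk>F holomorphic_on \<bbbD>;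
        \<And>u. u \<in> \<bbbD> \<Longrightarrow> (1 - (cmod u)\<^sup>2) powr \<alpha> * cmod (F u) \<le> N; z \<in> \<bbbD>\<rbrakk> \<Longrightarrow> ?wd F z \<le> C * N"
      using bloch_boundedE[OF ass bounded] by metis
    define K where "K = exp (1/2) * (2 * \<alpha>) powr \<alpha>"
    have "real (n + 1) powr \<alpha> * ?wd (\<lambda>u. u ^ n) z \<le> C * K" if "z \<in> \<bbbD>" for n z
    proof -
      \<comment> \<open>The monomial is itself the derivative \<open>F\<close>, and \<open>N\<close>
        may depend on n: since the bound C * N is linear in \<open>N\<close>, the decay (n + 1) powr
        -\<alpha> passes through and cancels the weight in (iv).\<close>
      have "?wd (\<lambda>u. u ^ n) z \<le> C * (K * real (n + 1) powr - \<alpha>)"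
        unfolding K_def using that \<alpha> by (intro C weight_power_bound holomorphic_intros)
      then have "real (n + 1) powr \<alpha> * ?wd (\<lambda>u. u ^ n) z
          \<le> real (n + 1) powr \<alpha> * (C * (K * real (n + 1) powr - \<alpha>))"
        by (rule mult_left_mono) simp
      also have "\<dots> = C * K" by (simp add: powr_minus)
      finally show ?thesis .
    qed
    then show ?thesis unfolding iv by blast
  qed
  moreover have "?iii" if iv_bound: "?iv"
  proof -
    from iv_bound obtain M where M: "\<And>n z. z \<in> \<bbbD> \<Longrightarrow> real (n + 1) powr \<alpha> * ?wd (\<lambda>u. u ^ n) z \<le> M"
      unfolding iv by blast
    from weighted_diff_test_from_powers[OF \<alpha>, of \<beta>] obtain C where
      "\<And>a z. a \<in> \<bbbD> \<Longrightarrow> z \<in> \<bbbD> \<Longrightarrow> ?wd (test_f' \<alpha> a) z \<le> M * C \<and> ?wd (test_g' \<alpha> a) z \<le> M * C"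
      using D M by metis
    then show ?thesis unfolding iii by blast
  qed
  ultimately show ?thesis by argo
qed

end
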